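(* For every $k\in\mathbb{N}$, every $k$-player game $\mathcal{G}=(\mathcal{Q},\mathcal{A},V,\pi)$, every $\epsilon>0$ and every $\delta>0$: if $\mathcal{V}_{\mathrm{subNS}}(\mathcal{G})\geq1-\epsilon$, then there exists a $k$-player game $\mathcal{G}^*=(\mathcal{Q},\mathcal{A}^*,V^*,\pi^* )$ such that (1) $\mathcal{A}^*=\mathcal{A}^*_1\times\cdots\times\mathcal{A}^*_k$ with $\mathcal{A}^*_i=A_i\cup\{*\}$ for each $i\in[k]$; (2) $V^*$ restricted to $\mathcal{Q}\times\mathcal{A}$ equals $V$, and $V^*\equiv0$ on $\mathcal{Q}\times(\mathcal{A}^*\setminus\mathcal{A})$; (3) $\pi$ and $\pi^*$ are $\delta$-close (statistical distance at most $\delta$); (4) $\mathcal{V}_{\mathrm{hrNS}}(\mathcal{G}^* )\geq\frac{1}{k^{3k}}\left(1-k^{2k}\epsilon/\delta\right)$. Moreover, if $\mathcal{V}_{\mathrm{subNS}_\delta}(\mathcal{G})\geq1-\epsilon$ and $\delta\leq\sqrt{\epsilon}$, then such $\mathcal{G}^*$ exists with $\pi^*=\pi$ and $\mathcal{V}_{\mathrm{NS}}(\mathcal{G}^* )\geq\frac{1}{k^{3k}}\left(1-k^{2k}\epsilon/\delta\right)$.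
   Context: A $k$-player game is $\mathcal{G}=(\mathcal{Q},\mathcal{A},V,\pi)$ where $\mathcal{Q}=Q_1\times\cdots\times Q_k$ and $\mathcal{A}=A_1\times\cdots\times A_k$ are finite sets, $V:\mathcal{Q}\times\mathcal{A}\to\{0,1\}$, and $\pi$ is a probability distribution on $\mathcal{Q}$. For $S\subseteq[k]$ write $\mathcal{Q}_S=\prod_{i\in S}Q_i$, $\mathcal{A}_S=\prod_{i\in S}A_i$, $q_S=(q_i)_{i\in S}$, $a_S=(a_i)_{i\in S}$. A strategy is a family $\{p_q\}_{q\in\mathcal{Q}}$ of probability distributions on $\mathcal{A}\cup\{\bot\}$; write $p_q(a_S)=\sum_{a^*\in\mathcal{A}:a^*_S=a_S}p_q(a^* )$. It is non-signaling if there exist probability distributions $\mathrm{Sim}_{S,q_S}$ on $\mathcal{A}_S$ (for all $S\subseteq[k]$, $q_S\in\mathcal{Q}_S$) with $p_q(a_S)=\mathrm{Sim}_{S,q_S}(a_S)$ for all $q\in\mathcal{Q}$, $S\subseteq[k]$, $a_S\in\mathcal{A}_S$; honest-referee non-signaling if this equality is required only for $q$ in the support of $\pi$; sub-non-signaling if $p_q(a_S)\leq\mathrm{Sim}_{S,q_S}(a_S)$ for all $q,S,a_S$. $\mathrm{subNS}_\delta(\mathcal{G})$ is the set of sub-non-signaling strategies with $p_q(\bot)\leq\delta$ for every $q$. For a class of strategies, the value of $\mathcal{G}$ is the maximum over that class of $\sum_q\pi(q)\sum_{a\in\mathcal{A}}p_q(a)V(q,a)$; $\mathcal{V}_{\mathrm{NS}},\mathcal{V}_{\mathrm{hrNS}},\mathcal{V}_{\mathrm{subNS}},\mathcal{V}_{\mathrm{subNS}_\delta}$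 denote the values over non-signaling, honest-referee non-signaling, sub-non-signaling and $\mathrm{subNS}_\delta(\mathcal{G})$ strategies respectively (for $\mathcal{G}^*$, with $\mathcal{A}^*$ in place of $\mathcal{A}$ and $\pi^*$ in place of $\pi$).
   Formalization: In the first part it is assumed that ε < 1 or δ ≤ 1, since otherwise the claim fails (k = 1, V ≡ 0, ε = 1, δ = 2: the value of G* is 0 but the bound is 1/2); the answer sets A_i are taken nonempty so that the values are defined. *)

theory Defs
  imports "HOL-Probability.Probability"
begin

text \<open>
  The players are \<open>1, \<dots>, k\<close>. Tuples indexed by a set \<open>S\<close> of players are extensional functions
  in \<open>Pi\<^sub>E S X\<close>, and the projection of a tuple \<open>x\<close> to \<open>S\<close> is \<open>restrict x S\<close>.
  The alphabets of the players are finite subsets of common types \<open>'q\<close> and \<open>'a\<close>.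
\<close>

record ('q, 'a) game =
  questions :: "nat \<Rightarrow> 'q set"
  answers :: "nat \<Rightarrow> 'a set"
  accepts :: "(nat \<Rightarrow> 'q) \<Rightarrow> (nat \<Rightarrow> 'a) \<Rightarrow> bool"
  qdist :: "(nat \<Rightarrow> 'q) pmf"

definition qtuples :: "('q, 'a) game \<Rightarrow> nat set \<Rightarrow> (nat \<Rightarrow> 'q) set" where
  "qtuples G S = Pi\<^sub>E S (questions G)"

definition atuples :: "('q, 'a) game \<Rightarrow> nat set \<Rightarrow> (nat \<Rightarrow> 'a) set" where
  "atuples G S = Pi\<^sub>E S (answers G)"

text \<open>
  Answer alphabets are required to be nonempty: otherwise there are no distributions on
  \<open>atuples G S\<close> and the classes of strategies below are empty. Nonemptiness of the
  question alphabets follows from the existence of \<open>qdist G\<close>.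
\<close>

definition is_game :: "nat \<Rightarrow> ('q, 'a) game \<Rightarrow> bool" where
  "is_game k G \<longleftrightarrow>
     (\<forall>i\<in>{1..k}. finite (questions G i) \<and> finite (answers G i) \<and> answers G i \<noteq> {}) \<and>
     set_pmf (qdist G) \<subseteq> qtuples G {1..k}"

text \<open>In a strategy, \<open>None\<close> is the abort symbol \<open>\<bottom>\<close>.\<close>

type_synonym ('q, 'a) strategy = "(nat \<Rightarrow> 'q) \<Rightarrow> (nat \<Rightarrow> 'a) option pmf"

definition is_strategy :: "nat \<Rightarrow> ('q, 'a) game \<Rightarrow> ('q, 'a) strategy \<Rightarrow> bool" where
  "is_strategy k G p \<longleftrightarrow>
     (\<forall>q\<in>qtuples G {1..k}. set_pmf (p q) \<subseteq> insert None (Some ` atuples G {1..k}))"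

definition marg ::
  "nat \<Rightarrow> ('q, 'a) game \<Rightarrow> ('q, 'a) strategy \<Rightarrow> (nat \<Rightarrow> 'q) \<Rightarrow> nat set \<Rightarrow> (nat \<Rightarrow> 'a) \<Rightarrow> real" where
  "marg k G p q S a = (\<Sum>b\<in>{b \<in> atuples G {1..k}. restrict b S = a}. pmf (p q) (Some b))"

definition is_sim ::
  "nat \<Rightarrow> ('q, 'a) game \<Rightarrow> (nat set \<Rightarrow> (nat \<Rightarrow> 'q) \<Rightarrow> (nat \<Rightarrow> 'a) pmf) \<Rightarrow> bool" where
  "is_sim k G Sim \<longleftrightarrow> (\<forall>S\<subseteq>{1..k}. \<forall>x\<in>qtuples G S. set_pmf (Sim S x) \<subseteq> atuples G S)"

definition NS :: "nat \<Rightarrow> ('q, 'a) game \<Rightarrow> ('q, 'a) strategy set" where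
  "NS k G = {p. is_strategy k G p \<and>
     (\<exists>Sim. is_sim k G Sim \<and>
        (\<forall>q\<in>qtuples G {1..k}. \<forall>S\<subseteq>{1..k}. \<forall>a\<in>atuples G S.
           marg k G p q S a = pmf (Sim S (restrict q S)) a))}"

definition hrNS :: "nat \<Rightarrow> ('q, 'a) game \<Rightarrow> ('q, 'a) strategy set" where
  "hrNS k G = {p. is_strategy k G p \<and>
     (\<exists>Sim. is_sim k G Sim \<and>
        (\<forall>q\<in>set_pmf (qdist G). \<forall>S\<subseteq>{1..k}. \<forall>a\<in>atuples G S.
           marg k G p q S a = pmf (Sim S (restrict q S)) a))}"

definition subNS :: "nat \<Rightarrow> ('q, 'a) game \<Rightarrow> ('q, 'a) strategy set" where
  "subNS k G = {p. is_strategy k G p \<and>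
     (\<exists>Sim. is_sim k G Sim \<and>
        (\<forall>q\<in>qtuples G {1..k}. \<forall>S\<subseteq>{1..k}. \<forall>a\<in>atuples G S.
           marg k G p q S a \<le> pmf (Sim S (restrict q S)) a))}"

definition subNS_le :: "real \<Rightarrow> nat \<Rightarrow> ('q, 'a) game \<Rightarrow> ('q, 'a) strategy set" where
  "subNS_le \<delta> k G = {p \<in> subNS k G. \<forall>q\<in>qtuples G {1..k}. pmf (p q) None \<le> \<delta>}"

definition win_prob :: "nat \<Rightarrow> ('q, 'a) game \<Rightarrow> ('q, 'a) strategy \<Rightarrow> real" where
  "win_prob k G p =
     (\<Sum>q\<in>qtuples G {1..k}. pmf (qdist G) q *
        (\<Sum>a\<in>atuples G {1..k}. pmf (p q) (Some a) * of_bool (accepts G q a)))"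

text \<open>
  For each of the classes above, \<open>win_prob k G\<close> attains its maximum (a linear functional
  on a nonempty compact set of strategies), so the supremum is that maximum.
\<close>

definition game_value :: "nat \<Rightarrow> ('q, 'a) game \<Rightarrow> ('q, 'a) strategy set \<Rightarrow> real" where
  "game_value k G C = (SUP p\<in>C. win_prob k G p)"

definition stat_dist :: "'b set \<Rightarrow> 'b pmf \<Rightarrow> 'b pmf \<Rightarrow> real" where
  "stat_dist X \<mu> \<nu> = (\<Sum>x\<in>X. \<bar>pmf \<mu> x - pmf \<nu> x\<bar>) / 2"

text \<open>
  The games obtained from \<open>G\<close> by adding a new answer \<open>*\<close> for every player, rejecting whenever
  some player answers \<open>*\<close>, and possibly changing the question distribution. The answer
  \<open>*\<close> is \<open>None :: 'a option\<close> and \<open>a \<in> A\<^sub>i\<close> is identified with \<open>Some a\<close>; this \<open>None\<close> is one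
  player's answer, unlike the abort symbol of strategies.
\<close>

definition embed_answers :: "nat \<Rightarrow> (nat \<Rightarrow> 'a) \<Rightarrow> nat \<Rightarrow> 'a option" where
  "embed_answers k a = (\<lambda>i\<in>{1..k}. Some (a i))"

definition star_game :: "nat \<Rightarrow> ('q, 'a) game \<Rightarrow> ('q, 'a option) game \<Rightarrow> bool" where
  "star_game k G H \<longleftrightarrow>
     is_game k H \<and>
     (\<forall>i\<in>{1..k}. questions H i = questions G i) \<and>
     (\<forall>i\<in>{1..k}. answers H i = insert None (Some ` answers G i)) \<and>
     (\<forall>q\<in>qtuples G {1..k}. \<forall>a\<in>atuples G {1..k}.
        accepts H q (embed_answers k a) \<longleftrightarrow> accepts G q a) \<and>
     (\<forall>q\<in>qtuples G {1..k}. \<forall>b\<in>atuples H {1..k} - embed_answers k ` atuples G {1..k}.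
        \<not> accepts H q b)"

end

theory Submission
  imports Defs
begin

text \<open>
  Fix a question tuple and let \<open>\<sigma> S\<close> be the simulated distribution of the answers of \<open>S\<close>. If the
  abort probability is at most \<open>\<eta>\<close>, then \<open>\<sigma> S\<close> and \<open>\<sigma> T\<close> both dominate the answer distribution, whose
  mass is at least \<open>1 - \<eta>\<close>, so they disagree on their common marginals by at most \<open>\<eta>\<close>. Trimming the \<open>\<sigma> S\<close>,
  by recursion on the size of \<open>S\<close>, gives a monotone family \<open>h\<close>: the marginal of \<open>h S\<close> to \<open>T \<subseteq> S\<close> lies
  pointwise below \<open>h T\<close>. The mass lost is at most \<open>(s^s - 1) * \<eta>\<close> with \<open>s = card S\<close>.

  Now ask that all players in \<open>S\<close> give the starless answers \<open>a\<close> with probability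
  \<open>\<beta>^(card S) * h S a\<close>, where \<open>\<beta> = 1 / k^3\<close>. Inclusion-exclusion
  determines the probabilities of all answer tuples with stars. Their marginal to \<open>S\<close> involves only \<open>h T\<close>
  with \<open>T \<subseteq> S\<close>, hence only the questions of \<open>S\<close>, so the strategy is non-signaling. The probabilities are
  nonnegative because the factors \<open>\<beta>\<close> make the leading term dominate: \<open>(1 + \<beta>)^k \<le> 2\<close>.

  For honest-referee strategies, \<open>\<pi>\<close> is conditioned on the questions where the given strategy fails with
  probability at most about \<open>\<epsilon> / \<delta>\<close>, which by Markov's inequality moves it by at most \<open>\<delta>\<close>. Near-optimal
  strategies suffice, since only finitely many conditioned games occur.
\<close>

section \<open>Marginals of functions on finite product sets\<close>

definition proj_sum ::
  "('i \<Rightarrow> 'b set) \<Rightarrow> 'i set \<Rightarrow> (('i \<Rightarrow> 'b) \<Rightarrow> real) \<Rightarrow> 'i set \<Rightarrow> ('i \<Rightarrow> 'b) \<Rightarrow> real" where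
  "proj_sum A S f T c = (\<Sum>a\<in>{a \<in> Pi\<^sub>E S A. restrict a T = c}. f a)"

lemma restrict_in_PiE: "a \<in> Pi\<^sub>E S A \<Longrightarrow> T \<subseteq> S \<Longrightarrow> restrict a T \<in> Pi\<^sub>E T A"
  by (auto simp: PiE_iff)

lemma finite_PiE_subset:
  assumes "finite I" "\<And>i. i \<in> I \<Longrightarrow> finite (A i)" "S \<subseteq> I"
  shows "finite (Pi\<^sub>E S A)"
  using assms by (intro finite_PiE) (auto intro: finite_subset)

lemma proj_sum_mono:
  "(\<And>a. a \<in> Pi\<^sub>E S A \<Longrightarrow> f a \<le> g a) \<Longrightarrow> proj_sum A S f T c \<le> proj_sum A S g T c"
  unfolding proj_sum_def by (rule sum_mono) auto

lemma proj_sum_nonneg: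
  "(\<And>a. a \<in> Pi\<^sub>E S A \<Longrightarrow> 0 \<le> f a) \<Longrightarrow> 0 \<le> proj_sum A S f T c"
  unfolding proj_sum_def by (rule sum_nonneg) auto

lemma sum_proj_sum:
  assumes "finite (Pi\<^sub>E S A)" "finite (Pi\<^sub>E T A)" "T \<subseteq> S"
  shows "(\<Sum>c\<in>Pi\<^sub>E T A. proj_sum A S f T c) = (\<Sum>a\<in>Pi\<^sub>E S A. f a)"
  unfolding proj_sum_def
  by (rule sum.group) (use assms in \<open>auto intro: restrict_in_PiE\<close>)

lemma sum_proj_sum_mult:
  assumes "finite (Pi\<^sub>E S A)" "finite (Pi\<^sub>E T A)" "T \<subseteq> S"
  shows "(\<Sum>a\<in>Pi\<^sub>E S A. f a * g (restrict a T)) = (\<Sum>c\<in>Pi\<^sub>E T A. proj_sum A S f T c * g c)"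
proof -
  have "(\<Sum>a\<in>Pi\<^sub>E S A. f a * g (restrict a T))
      = (\<Sum>c\<in>Pi\<^sub>E T A. \<Sum>a\<in>{a \<in> Pi\<^sub>E S A. restrict a T = c}. f a * g (restrict a T))"
    by (rule sum.group[symmetric]) (use assms in \<open>auto intro: restrict_in_PiE\<close>)
  also have "\<dots> = (\<Sum>c\<in>Pi\<^sub>E T A. proj_sum A S f T c * g c)"
    unfolding proj_sum_def sum_distrib_right by (intro sum.cong) auto
  finally show ?thesis .
qed

text \<open>Restricting to \<open>T\<close> and then to \<open>U\<close> is the same as restricting
  to \<open>U\<close>, so the fibres over \<open>T\<close> partition each fibre over
  \<open>U\<close>.\<close>

lemma proj_sum_proj_sum:
  assumes "finite (Pi\<^sub>E S A)" "finite (Pi\<^sub>E T A)" "U \<subseteq> T" "T \<subseteq> S"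
  shows "proj_sum A T (proj_sum A S f T) U c = proj_sum A S f U c"
proof -
  have "proj_sum A T (proj_sum A S f T) U c
      = (\<Sum>d\<in>{d \<in> Pi\<^sub>E T A. restrict d U = c}.
           \<Sum>a\<in>{a \<in> {a \<in> Pi\<^sub>E S A. restrict a U = c}. restrict a T = d}. f a)"
    unfolding proj_sum_def
    using assms(3) by (intro sum.cong refl) (auto simp: restrict_restrict Int_absorb1)
  also have "\<dots> = (\<Sum>a\<in>{a \<in> Pi\<^sub>E S A. restrict a U = c}. f a)"
    by (rule sum.group) (use assms in \<open>auto intro: restrict_in_PiE simp: Int_absorb1 Int_absorb2\<close>)
  finally show ?thesis by (simp add: proj_sum_def)
qed

lemma proj_sum_same:
  assumes "c \<in> Pi\<^sub>E S A"
  shows "proj_sum A S f S c = f c"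
proof -
  have "{a \<in> Pi\<^sub>E S A. restrict a S = c} = {c}"
    using assms by (auto simp: PiE_restrict)
  then show ?thesis by (simp add: proj_sum_def)
qed

section \<open>Trimming a family of distributions to monotone marginals\<close>

text \<open>
  The factor \<open>i\<close> of the product scales the marginal of \<open>\<sigma> S\<close> to \<open>S - {i}\<close> below the trimmed function
  there. Where that marginal vanishes, so does \<open>\<sigma> S a\<close>, and the junk value \<open>x / 0 = 0\<close> is harmless.
  The argument \<open>n\<close> is meant to be \<open>card S\<close>.
\<close>

primrec trim ::
  "('i \<Rightarrow> 'b set) \<Rightarrow> ('i set \<Rightarrow> ('i \<Rightarrow> 'b) \<Rightarrow> real) \<Rightarrow> nat \<Rightarrow> 'i set \<Rightarrow> ('i \<Rightarrow> 'b) \<Rightarrow> real" where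
  "trim A \<sigma> 0 S a = \<sigma> S a"
| "trim A \<sigma> (Suc n) S a = \<sigma> S a *
     (\<Prod>i\<in>S. min 1 (trim A \<sigma> n (S - {i}) (restrict a (S - {i})) /
        proj_sum A S (\<sigma> S) (S - {i}) (restrict a (S - {i}))))"

definition trimmed ::
  "('i \<Rightarrow> 'b set) \<Rightarrow> ('i set \<Rightarrow> ('i \<Rightarrow> 'b) \<Rightarrow> real) \<Rightarrow> 'i set \<Rightarrow> ('i \<Rightarrow> 'b) \<Rightarrow> real" where
  "trimmed A \<sigma> S = trim A \<sigma> (card S) S"

lemma trimmed_empty: "trimmed A \<sigma> {} = \<sigma> {}"
  by (simp add: trimmed_def fun_eq_iff)

lemma trimmed_rec:
  assumes "finite S"
  shows "trimmed A \<sigma> S a = \<sigma> S a *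
     (\<Prod>i\<in>S. min 1 (trimmed A \<sigma> (S - {i}) (restrict a (S - {i})) /
        proj_sum A S (\<sigma> S) (S - {i}) (restrict a (S - {i}))))"
proof (cases "S = {}")
  case False
  then obtain n where n: "card S = Suc n"
    using assms by (metis card_eq_0_iff not0_implies_Suc)
  then have "card (S - {i}) = n" if "i \<in> S" for i
    using that assms by simp
  with n show ?thesis by (simp add: trimmed_def)
qed (simp add: trimmed_def)

text \<open>The recursion only descends to subsets of \<open>S\<close>. This locality is what later
  makes the answers of \<open>S\<close> depend on the questions of \<open>S\<close> alone.\<close>

lemma trim_cong:
  assumes "\<And>T. T \<subseteq> S \<Longrightarrow> \<sigma> T = \<tau> T"
  shows "trim A \<sigma> n S = trim A \<tau> n S"
  using assms
proof (induction n arbitrary: S)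
  case (Suc n)
  have IH: "trim A \<sigma> n (S - {i}) = trim A \<tau> n (S - {i})" for i
    by (rule Suc.IH) (use Suc.prems in auto)
  have "\<sigma> S = \<tau> S"
    by (rule Suc.prems) simp
  then show ?case by (intro ext) (simp only: trim.simps IH)
qed auto

lemma trimmed_cong: "(\<And>T. T \<subseteq> S \<Longrightarrow> \<sigma> T = \<tau> T) \<Longrightarrow> trimmed A \<sigma> S = trimmed A \<tau> S"
  unfolding trimmed_def by (rule trim_cong)

locale finite_alphabets =
  fixes I :: "'i set" and A :: "'i \<Rightarrow> 'b set"
  assumes finI: "finite I" and finA: "\<And>i. i \<in> I \<Longrightarrow> finite (A i)"
begin

lemma fin_PiE: "S \<subseteq> I \<Longrightarrow> finite (Pi\<^sub>E S A)"
  by (rule finite_PiE_subset[OF finI finA])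

lemma finite_sub: "S \<subseteq> I \<Longrightarrow> finite S"
  by (rule finite_subset[OF _ finI])

lemma trimmed_nonneg:
  assumes "\<And>S a. S \<subseteq> I \<Longrightarrow> a \<in> Pi\<^sub>E S A \<Longrightarrow> 0 \<le> \<sigma> S a" "S \<subseteq> I" "a \<in> Pi\<^sub>E S A"
  shows "0 \<le> trimmed A \<sigma> S a"
  using assms(2,3)
proof (induction "card S" arbitrary: S a rule: less_induct)
  case less
  have fin: "finite S" using less.prems finite_sub by blast
  have "0 \<le> min 1 (trimmed A \<sigma> (S - {i}) (restrict a (S - {i})) /
        proj_sum A S (\<sigma> S) (S - {i}) (restrict a (S - {i})))" if "i \<in> S" for i
  proof -
    have "0 \<le> trimmed A \<sigma> (S - {i}) (restrict a (S - {i}))"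
      using that fin less.prems
      by (intro less.hyps card_Diff1_less restrict_in_PiE[of _ S]) auto
    moreover have "0 \<le> proj_sum A S (\<sigma> S) (S - {i}) (restrict a (S - {i}))"
      using assms(1) less.prems by (intro proj_sum_nonneg) auto
    ultimately show ?thesis by simp
  qed
  then show ?case
    unfolding trimmed_rec[OF fin] using assms(1) less.prems
    by (intro mult_nonneg_nonneg prod_nonneg) auto
qed

end

text \<open>The situation at one question tuple: \<open>p\<close> is the subdistribution of
  non-aborting answers, \<open>\<sigma> S\<close> the simulator for the players in \<open>S\<close>,
  and \<open>\<eta>\<close> bounds the abort probability.\<close>

locale overlapping_family = finite_alphabets I A
  for I :: "'i set" and A :: "'i \<Rightarrow> 'b set" +
  fixes \<sigma> :: "'i set \<Rightarrow> ('i \<Rightarrow> 'b) \<Rightarrow> real" and p :: "('i \<Rightarrow> 'b) \<Rightarrow> real" and \<eta> :: real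
  assumes \<sigma>_nonneg: "\<And>S a. S \<subseteq> I \<Longrightarrow> a \<in> Pi\<^sub>E S A \<Longrightarrow> 0 \<le> \<sigma> S a"
    and \<sigma>_total: "\<And>S. S \<subseteq> I \<Longrightarrow> (\<Sum>a\<in>Pi\<^sub>E S A. \<sigma> S a) = 1"
    and p_nonneg: "\<And>a. a \<in> Pi\<^sub>E I A \<Longrightarrow> 0 \<le> p a"
    and p_le: "\<And>S a. S \<subseteq> I \<Longrightarrow> a \<in> Pi\<^sub>E S A \<Longrightarrow> proj_sum A I p S a \<le> \<sigma> S a"
    and p_total: "1 - \<eta> \<le> (\<Sum>a\<in>Pi\<^sub>E I A. p a)"
begin

abbreviation h where "h \<equiv> trimmed A \<sigma>"

lemma h_nonneg: "S \<subseteq> I \<Longrightarrow> a \<in> Pi\<^sub>E S A \<Longrightarrow> 0 \<le> h S a"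
  using trimmed_nonneg[of \<sigma> S a] \<sigma>_nonneg by blast

lemma eta_nonneg: "0 \<le> \<eta>"
proof -
  have "(\<Sum>a\<in>Pi\<^sub>E I A. p a) \<le> (\<Sum>a\<in>Pi\<^sub>E I A. \<sigma> I a)"
    using p_le[of I] by (intro sum_mono) (simp add: proj_sum_same)
  then show ?thesis using p_total \<sigma>_total[of I] by simp
qed

text \<open>All factors of the product lie between 0 and 1, so keeping only the factor of
  \<open>i\<close> gives an upper bound.\<close>

lemma h_le_step:
  assumes "S \<subseteq> I" "i \<in> S" "a \<in> Pi\<^sub>E S A"
  shows "h S a \<le> \<sigma> S a * min 1 (h (S - {i}) (restrict a (S - {i})) /
        proj_sum A S (\<sigma> S) (S - {i}) (restrict a (S - {i})))"
proof -
  have fin: "finite S" using assms finite_sub by blast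
  let ?r = "\<lambda>i. min 1 (h (S - {i}) (restrict a (S - {i})) /
        proj_sum A S (\<sigma> S) (S - {i}) (restrict a (S - {i})))"
  have nn: "0 \<le> ?r j" for j
  proof -
    have "0 \<le> h (S - {j}) (restrict a (S - {j}))"
      using assms by (intro h_nonneg restrict_in_PiE[of _ S]) auto
    moreover have "0 \<le> proj_sum A S (\<sigma> S) (S - {j}) (restrict a (S - {j}))"
      using \<sigma>_nonneg assms by (intro proj_sum_nonneg) auto
    ultimately show ?thesis by simp
  qed
  have "(\<Prod>j\<in>S. ?r j) = ?r i * (\<Prod>j\<in>S-{i}. ?r j)"
    using fin assms(2) by (rule prod.remove)
  also have "\<dots> \<le> ?r i * 1"
    using nn by (intro mult_left_mono prod_le_1) auto
  finally show ?thesis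
    unfolding trimmed_rec[OF fin] using \<sigma>_nonneg[OF assms(1,3)] by (intro mult_left_mono) auto
qed

text \<open>The factor of \<open>i\<close> depends only on the restriction to
  \<open>S - {i}\<close>, so it is constant on the fibre over \<open>c\<close> and can be pulled out
  of the marginal.\<close>

lemma proj_h_step:
  assumes "S \<subseteq> I" "i \<in> S" "c \<in> Pi\<^sub>E (S - {i}) A"
  shows "proj_sum A S (h S) (S - {i}) c \<le> h (S - {i}) c"
proof -
  let ?s = "proj_sum A S (\<sigma> S) (S - {i}) c"
  have hc: "0 \<le> h (S - {i}) c" using assms by (intro h_nonneg) auto
  have s: "0 \<le> ?s" using \<sigma>_nonneg assms by (intro proj_sum_nonneg) auto
  have "proj_sum A S (h S) (S - {i}) c
      \<le> (\<Sum>a\<in>{a \<in> Pi\<^sub>E S A. restrict a (S - {i}) = c}. \<sigma> S a * min 1 (h (S - {i}) c / ?s))"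
    unfolding proj_sum_def[of A S "h S"]
    by (rule sum_mono) (use h_le_step[OF assms(1,2)] in auto)
  also have "\<dots> = ?s * min 1 (h (S - {i}) c / ?s)"
    by (simp add: proj_sum_def sum_distrib_right)
  also have "\<dots> \<le> h (S - {i}) c"
  proof (cases "?s = 0")
    case False
    then have "?s * min 1 (h (S - {i}) c / ?s) \<le> ?s * (h (S - {i}) c / ?s)"
      using s by (intro mult_left_mono) auto
    with False show ?thesis by simp
  qed (use hc in simp)
  finally show ?thesis .
qed

text \<open>The players in \<open>S - T\<close> are summed out one at a time, each by
  \<open>proj_h_step\<close>.\<close>

lemma proj_h_le:
  assumes "T \<subseteq> S" "S \<subseteq> I" "c \<in> Pi\<^sub>E T A"
  shows "proj_sum A S (h S) T c \<le> h T c"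
  using assms(1,2)
proof (induction "card (S - T)" arbitrary: S)
  case 0
  then have "S = T" using finite_sub[of S] by auto
  with assms(3) show ?case by (simp add: proj_sum_same)
next
  case (Suc n)
  have "S - T \<noteq> {}" using Suc.hyps(2) by (metis card.empty nat.distinct(1))
  then obtain i where i: "i \<in> S" "i \<notin> T" by auto
  have eq: "S - {i} - T = (S - T) - {i}" by auto
  have "n = card (S - {i} - T)"
    unfolding eq using Suc.hyps(2) i finite_sub[OF Suc.prems(2)] by simp
  then have IH: "proj_sum A (S - {i}) (h (S - {i})) T c \<le> h T c"
    using Suc.prems i by (intro Suc.hyps(1)) auto
  have "proj_sum A S (h S) T c = proj_sum A (S - {i}) (proj_sum A S (h S) (S - {i})) T c"
    using Suc.prems i by (intro proj_sum_proj_sum[symmetric] fin_PiE) auto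
  also have "\<dots> \<le> proj_sum A (S - {i}) (h (S - {i})) T c"
    using Suc.prems i by (intro proj_sum_mono proj_h_step) auto
  finally show ?case using IH by linarith
qed

lemma h_le_\<sigma>:
  assumes "S \<subseteq> I" "a \<in> Pi\<^sub>E S A"
  shows "h S a \<le> \<sigma> S a"
proof (cases "S = {}")
  case False
  then obtain i where i: "i \<in> S" by auto
  have "h S a \<le> \<sigma> S a * min 1 (h (S - {i}) (restrict a (S - {i})) /
        proj_sum A S (\<sigma> S) (S - {i}) (restrict a (S - {i})))"
    by (rule h_le_step[OF assms(1) i assms(2)])
  also have "\<dots> \<le> \<sigma> S a * 1"
    using \<sigma>_nonneg[OF assms] by (intro mult_left_mono) auto
  finally show ?thesis by simp
qed (simp add: trimmed_empty)

text \<open>The marginals of \<open>p\<close> lie below both functions, so the positive part is at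
  most the excess of the marginal of \<open>\<sigma> S\<close> over that of \<open>p\<close>, and
  this excess has total mass \<open>1 - sum p\<close>.\<close>

lemma inconsistency_le:
  assumes "T \<subseteq> S" "S \<subseteq> I"
  shows "(\<Sum>c\<in>Pi\<^sub>E T A. max 0 (proj_sum A S (\<sigma> S) T c - \<sigma> T c)) \<le> \<eta>"
proof -
  have TI: "T \<subseteq> I" using assms by auto
  have "(\<Sum>c\<in>Pi\<^sub>E T A. max 0 (proj_sum A S (\<sigma> S) T c - \<sigma> T c))
      \<le> (\<Sum>c\<in>Pi\<^sub>E T A. proj_sum A S (\<sigma> S) T c - proj_sum A I p T c)"
  proof (rule sum_mono)
    fix c assume c: "c \<in> Pi\<^sub>E T A"
    have "proj_sum A I p T c = proj_sum A S (proj_sum A I p S) T c"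
      using assms TI by (intro proj_sum_proj_sum[symmetric] fin_PiE) auto
    also have "\<dots> \<le> proj_sum A S (\<sigma> S) T c"
      using assms by (intro proj_sum_mono p_le)
    finally show "max 0 (proj_sum A S (\<sigma> S) T c - \<sigma> T c)
        \<le> proj_sum A S (\<sigma> S) T c - proj_sum A I p T c"
      using p_le[OF TI c] by simp
  qed
  also have "\<dots> = 1 - (\<Sum>a\<in>Pi\<^sub>E I A. p a)"
    using assms TI by (simp add: sum_subtractf sum_proj_sum fin_PiE \<sigma>_total)
  finally show ?thesis using p_total by simp
qed

text \<open>A product of factors \<open>r i\<close> in [0,1] falls short of 1 by at most the sum of
  the \<open>1 - r i\<close>. Weighted by \<open>\<sigma> S\<close>, each summand is exactly the
  mass by which one marginal exceeds its trimmed bound.\<close>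

lemma loss_step:
  assumes "S \<subseteq> I"
  shows "(\<Sum>a\<in>Pi\<^sub>E S A. \<sigma> S a - h S a)
    \<le> (\<Sum>i\<in>S. \<Sum>c\<in>Pi\<^sub>E (S - {i}) A. max 0 (proj_sum A S (\<sigma> S) (S - {i}) c - h (S - {i}) c))"
proof -
  have fin: "finite S" using assms finite_sub by blast
  let ?r = "\<lambda>i c. min 1 (h (S - {i}) c / proj_sum A S (\<sigma> S) (S - {i}) c)"
  have nn: "0 \<le> ?r j c" if "c \<in> Pi\<^sub>E (S - {j}) A" for j c
  proof -
    have "0 \<le> h (S - {j}) c"
      using assms that by (intro h_nonneg) auto
    moreover have "0 \<le> proj_sum A S (\<sigma> S) (S - {j}) c"
      using \<sigma>_nonneg assms by (intro proj_sum_nonneg) auto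
    ultimately show ?thesis by simp
  qed
  have "(\<Sum>a\<in>Pi\<^sub>E S A. \<sigma> S a - h S a)
      \<le> (\<Sum>a\<in>Pi\<^sub>E S A. \<Sum>i\<in>S. \<sigma> S a * (1 - ?r i (restrict a (S - {i}))))"
  proof (rule sum_mono)
    fix a assume a: "a \<in> Pi\<^sub>E S A"
    have "1 - (\<Sum>i\<in>S. 1 - ?r i (restrict a (S - {i})))
        \<le> (\<Prod>i\<in>S. 1 - (1 - ?r i (restrict a (S - {i}))))"
    proof (rule Weierstrass_prod_ineq)
      fix i assume "i \<in> S"
      have "0 \<le> ?r i (restrict a (S - {i}))"
        by (rule nn) (use a in \<open>auto intro: restrict_in_PiE\<close>)
      then show "1 - ?r i (restrict a (S - {i})) \<in> {0..1}" by simp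
    qed
    then have "\<sigma> S a * (1 - (\<Prod>i\<in>S. ?r i (restrict a (S - {i}))))
        \<le> \<sigma> S a * (\<Sum>i\<in>S. 1 - ?r i (restrict a (S - {i})))"
      using \<sigma>_nonneg[OF assms a] by (intro mult_left_mono) auto
    then show "\<sigma> S a - h S a \<le> (\<Sum>i\<in>S. \<sigma> S a * (1 - ?r i (restrict a (S - {i}))))"
      unfolding trimmed_rec[OF fin, of A \<sigma> a] sum_distrib_left
      by (simp only: right_diff_distrib mult_1_right)
  qed
  also have "\<dots> = (\<Sum>i\<in>S. \<Sum>a\<in>Pi\<^sub>E S A. \<sigma> S a * (1 - ?r i (restrict a (S - {i}))))"
    by (rule sum.swap)
  also have "\<dots> = (\<Sum>i\<in>S. \<Sum>c\<in>Pi\<^sub>E (S - {i}) A. proj_sum A S (\<sigma> S) (S - {i}) c * (1 - ?r i c))"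
  proof (rule sum.cong[OF refl])
    fix i
    show "(\<Sum>a\<in>Pi\<^sub>E S A. \<sigma> S a * (1 - ?r i (restrict a (S - {i}))))
        = (\<Sum>c\<in>Pi\<^sub>E (S - {i}) A. proj_sum A S (\<sigma> S) (S - {i}) c * (1 - ?r i c))"
      by (rule sum_proj_sum_mult[where g = "\<lambda>c. 1 - ?r i c"]) (use assms in \<open>auto intro: fin_PiE\<close>)
  qed
  also have "\<dots> = (\<Sum>i\<in>S. \<Sum>c\<in>Pi\<^sub>E (S - {i}) A. max 0 (proj_sum A S (\<sigma> S) (S - {i}) c - h (S - {i}) c))"
  proof (intro sum.cong refl)
    fix i c assume c: "c \<in> Pi\<^sub>E (S - {i}) A"
    let ?s = "proj_sum A S (\<sigma> S) (S - {i}) c"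
    have hc: "0 \<le> h (S - {i}) c" using assms c by (intro h_nonneg) auto
    have s: "0 \<le> ?s" using \<sigma>_nonneg assms by (intro proj_sum_nonneg) auto
    show "?s * (1 - ?r i c) = max 0 (?s - h (S - {i}) c)"
      using hc s by (cases "?s = 0") (auto simp: min_def max_def field_simps)
  qed
  finally show ?thesis .
qed

text \<open>Each of the \<open>s\<close> players costs the inconsistency \<open>\<eta>\<close> plus
  the loss already incurred at \<open>S - {i}\<close>. By induction this is at most
  \<open>s * (s-1)^(s-1) * \<eta>\<close>, which is at most \<open>(s^s - 1) * \<eta>\<close> for
  \<open>s > 1\<close>.\<close>

lemma loss_le:
  assumes "S \<subseteq> I"
  shows "(\<Sum>a\<in>Pi\<^sub>E S A. \<sigma> S a - h S a) \<le> (real (card S) ^ card S - 1) * \<eta>"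
  using assms
proof (induction "card S" arbitrary: S)
  case 0
  then have "S = {}" using finite_sub[of S] by auto
  then show ?case by (simp add: trimmed_empty)
next
  case (Suc n)
  have fin: "finite S" using Suc.prems finite_sub by blast
  \<comment> \<open>The case \<open>n = 0\<close> is separate because \<open>0 ^ 0 = 1\<close> would
    charge \<open>\<eta>\<close> to a singleton, whose claimed loss is 0. A singleton indeed loses
    nothing: its marginal to the empty set is its total mass 1, which equals
    \<open>\<sigma> {}\<close>.\<close>
  have step: "(\<Sum>c\<in>Pi\<^sub>E (S - {i}) A. max 0 (proj_sum A S (\<sigma> S) (S - {i}) c - h (S - {i}) c))
      \<le> (if n = 0 then 0 else real n ^ n * \<eta>)" if i: "i \<in> S" for i
  proof (cases "n = 0")
    case True
    then have S: "S = {i}" using Suc.hyps(2) i fin by (metis One_nat_def card_1_singletonE singletonD)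
    have "proj_sum A {i} (\<sigma> {i}) {} (\<lambda>_. undefined) = (\<Sum>a\<in>Pi\<^sub>E {i} A. \<sigma> {i} a)"
      unfolding proj_sum_def by (rule sum.cong) (auto simp: restrict_def)
    moreover have "\<sigma> {} (\<lambda>_. undefined) = 1"
      using \<sigma>_total[of "{}"] by simp
    ultimately show ?thesis
      using True Suc.prems \<sigma>_total[of "{i}"] by (simp add: S trimmed_empty)
  next
    case False
    have n: "n = card (S - {i})" using Suc.hyps(2) i fin by simp
    \<comment> \<open>The excess over \<open>h\<close> splits into the excess over
      \<open>\<sigma>\<close>, bounded by \<open>inconsistency_le\<close>, and the trimming loss at
      \<open>S - {i}\<close>, bounded by induction.\<close>
    have "(\<Sum>c\<in>Pi\<^sub>E (S - {i}) A. max 0 (proj_sum A S (\<sigma> S) (S - {i}) c - h (S - {i}) c))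
        \<le> (\<Sum>c\<in>Pi\<^sub>E (S - {i}) A. max 0 (proj_sum A S (\<sigma> S) (S - {i}) c - \<sigma> (S - {i}) c)
             + (\<sigma> (S - {i}) c - h (S - {i}) c))"
    proof (rule sum_mono)
      fix c assume "c \<in> Pi\<^sub>E (S - {i}) A"
      then have "h (S - {i}) c \<le> \<sigma> (S - {i}) c" using Suc.prems by (intro h_le_\<sigma>) auto
      then show "max 0 (proj_sum A S (\<sigma> S) (S - {i}) c - h (S - {i}) c)
          \<le> max 0 (proj_sum A S (\<sigma> S) (S - {i}) c - \<sigma> (S - {i}) c)
             + (\<sigma> (S - {i}) c - h (S - {i}) c)" by simp
    qed
    also have "\<dots> \<le> \<eta> + (real n ^ n - 1) * \<eta>"
      unfolding sum.distrib n
      using Suc.prems n by (intro add_mono inconsistency_le Suc.hyps(1)) auto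
    finally show ?thesis using False by (simp add: algebra_simps)
  qed
  have "(\<Sum>a\<in>Pi\<^sub>E S A. \<sigma> S a - h S a) \<le> (\<Sum>i\<in>S. if n = 0 then 0 else real n ^ n * \<eta>)"
    using loss_step[OF Suc.prems] sum_mono[OF step] by (rule order_trans)
  also have "\<dots> \<le> (real (Suc n) ^ Suc n - 1) * \<eta>"
  proof (cases "n = 0")
    case False
    \<comment> \<open>This follows from \<open>n^n + 1 \<le> (n+1)^n\<close>, multiplied by
      \<open>n + 1\<close>.\<close>
    have "(n + 1) * n ^ n + 1 \<le> (n + 1) ^ (n + 1)"
    proof -
      obtain m where m: "n = Suc m" using False not0_implies_Suc by blast
      have "n ^ n + 1 \<le> n * (n + 1) ^ m + (n + 1) ^ m"
        unfolding m power_Suc by (intro add_mono mult_left_mono power_mono) auto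
      also have "\<dots> = (n + 1) ^ n" by (simp add: m algebra_simps)
      finally have "(n + 1) * (n ^ n + 1) \<le> (n + 1) * (n + 1) ^ n"
        by (rule mult_left_mono) simp
      then show ?thesis by simp
    qed
    then have "real ((n + 1) * n ^ n + 1) \<le> real ((n + 1) ^ (n + 1))"
      by (rule of_nat_mono)
    then have "real (Suc n) * real n ^ n \<le> real (Suc n) ^ Suc n - 1"
      by (simp add: algebra_simps)
    then have "(real (Suc n) * real n ^ n) * \<eta> \<le> (real (Suc n) ^ Suc n - 1) * \<eta>"
      using eta_nonneg by (rule mult_right_mono)
    then show ?thesis using False Suc.hyps(2)[symmetric] by simp
  qed (use eta_nonneg in simp)
  finally show ?case using Suc.hyps(2) by simp
qed

end

section \<open>Inclusion-exclusion over starred answers\<close>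

abbreviation starred :: "('i \<Rightarrow> 'b set) \<Rightarrow> 'i \<Rightarrow> 'b option set" where
  "starred A i \<equiv> insert None (Some ` A i)"

text \<open>
  \<open>star_sign U a i (b i)\<close> is the factor of player \<open>i\<close> in the inclusion-exclusion coefficient of \<open>m U a\<close> in
  the weight of \<open>b\<close>. In product form, summing out a player is a one-factor computation:
  the factor sums to 0 for \<open>i \<in> U\<close> and to 1 otherwise.
\<close>

definition star_sign :: "'i set \<Rightarrow> ('i \<Rightarrow> 'b) \<Rightarrow> 'i \<Rightarrow> 'b option \<Rightarrow> real" where
  "star_sign U a i v =
     (if i \<in> U then (case v of None \<Rightarrow> -1 | Some x \<Rightarrow> of_bool (x = a i)) else of_bool (v = None))"

text \<open>Moebius inversion: if \<open>m U a\<close> is the desired probability that the players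
  in \<open>U\<close> answer \<open>a\<close>, and \<open>T\<close> is the set of players without a
  star in \<open>b\<close>, this is the alternating sum over \<open>U\<close> between
  \<open>T\<close> and \<open>S\<close>, with sign \<open>(-1)^card (U - T)\<close>, of the mass of
  \<open>m U\<close> on the extensions of the answers in \<open>b\<close>.\<close>

definition star_weight ::
  "('i \<Rightarrow> 'b set) \<Rightarrow> ('i set \<Rightarrow> ('i \<Rightarrow> 'b) \<Rightarrow> real) \<Rightarrow> 'i set \<Rightarrow> ('i \<Rightarrow> 'b option) \<Rightarrow> real" where
  "star_weight A m S b =
     (\<Sum>U\<in>Pow S. \<Sum>a\<in>Pi\<^sub>E U A. m U a * (\<Prod>i\<in>S. star_sign U a i (b i)))"

lemma star_weight_cong:
  "(\<And>T. T \<subseteq> S \<Longrightarrow> m T = m' T) \<Longrightarrow> star_weight A m S b = star_weight A m' S b"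
  unfolding star_weight_def by (intro sum.cong refl) auto

lemma sum_power_card_Pow:
  fixes \<beta> :: real
  assumes "finite X"
  shows "(\<Sum>V\<in>Pow X. \<beta> ^ card V) = (1 + \<beta>) ^ card X"
  using prod_add[OF assms, of "\<lambda>_. \<beta>" "\<lambda>_. 1"] by (simp add: add.commute)

context finite_alphabets
begin

lemma sum_star_sign:
  assumes "i \<in> I" "i \<in> U \<Longrightarrow> a i \<in> A i"
  shows "(\<Sum>v\<in>starred A i. star_sign U a i v) = of_bool (i \<notin> U)"
proof -
  have "(\<Sum>v\<in>starred A i. star_sign U a i v)
      = star_sign U a i None + (\<Sum>x\<in>A i. star_sign U a i (Some x))"
    using finA[OF assms(1)] by (subst sum.insert) (auto simp: sum.reindex)
  also have "(\<Sum>x\<in>A i. star_sign U a i (Some x)) = of_bool (i \<in> U)"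
    using assms finA[OF assms(1)] by (simp add: star_sign_def of_bool_def)
  finally show ?thesis by (simp add: star_sign_def)
qed

text \<open>Summing out a player outside \<open>S\<close> annihilates every term with that player in
  \<open>U\<close> and leaves the others unchanged, so exactly the terms with
  \<open>U \<subseteq> S\<close> survive.\<close>

lemma proj_star_weight:
  assumes SI: "S \<subseteq> I" and c: "c \<in> Pi\<^sub>E S (starred A)"
  shows "proj_sum (starred A) I (star_weight A m I) S c = star_weight A m S c"
proof -
  \<comment> \<open>The fibre over \<open>c\<close> is itself a product set, with singletons at the
    coordinates in \<open>S\<close>; hence the sum of products over it factors.\<close>
  define B where "B i = (if i \<in> S then {c i} else starred A i)" for i
  have B: "{b \<in> Pi\<^sub>E I (starred A). restrict b S = c} = Pi\<^sub>E I B"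
  proof (intro set_eqI iffI)
    fix b assume "b \<in> {b \<in> Pi\<^sub>E I (starred A). restrict b S = c}"
    then show "b \<in> Pi\<^sub>E I B" by (auto simp: B_def PiE_iff)
  next
    fix b assume b: "b \<in> Pi\<^sub>E I B"
    have "b i \<in> starred A i" if "i \<in> I" for i
      using PiE_mem[OF b that] PiE_mem[OF c, of i] by (auto simp: B_def split: if_splits)
    moreover have "restrict b S = c"
    proof (rule ext)
      fix i show "restrict b S i = c i"
        using PiE_mem[OF b, of i] SI PiE_arb[OF c, of i] by (auto simp: B_def)
    qed
    ultimately show "b \<in> {b \<in> Pi\<^sub>E I (starred A). restrict b S = c}"
      using b by (auto simp: PiE_iff)
  qed
  have prod: "(\<Sum>b\<in>Pi\<^sub>E I B. \<Prod>i\<in>I. star_sign U a i (b i))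
      = of_bool (U \<subseteq> S) * (\<Prod>i\<in>S. star_sign U a i (c i))"
    if U: "U \<subseteq> I" and a: "a \<in> Pi\<^sub>E U A" for U a
  proof -
    have "(\<Sum>b\<in>Pi\<^sub>E I B. \<Prod>i\<in>I. star_sign U a i (b i)) = (\<Prod>i\<in>I. \<Sum>v\<in>B i. star_sign U a i v)"
      by (rule prod_sum_PiE[symmetric]) (use finI finA in \<open>auto simp: B_def\<close>)
    also have "\<dots> = (\<Prod>i\<in>I-S. \<Sum>v\<in>B i. star_sign U a i v) * (\<Prod>i\<in>S. \<Sum>v\<in>B i. star_sign U a i v)"
      by (rule prod.subset_diff[OF SI finI])
    also have "(\<Prod>i\<in>S. \<Sum>v\<in>B i. star_sign U a i v) = (\<Prod>i\<in>S. star_sign U a i (c i))"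
      by (rule prod.cong) (auto simp: B_def)
    also have "(\<Prod>i\<in>I-S. \<Sum>v\<in>B i. star_sign U a i v) = (\<Prod>i\<in>I-S. of_bool (i \<notin> U))"
    proof (rule prod.cong[OF refl])
      fix i assume i: "i \<in> I - S"
      then have "(\<Sum>v\<in>starred A i. star_sign U a i v) = of_bool (i \<notin> U)"
        using a by (intro sum_star_sign) auto
      with i show "(\<Sum>v\<in>B i. star_sign U a i v) = of_bool (i \<notin> U)" by (simp add: B_def)
    qed
    also have "\<dots> = of_bool (U \<subseteq> S)"
    proof (cases "U \<subseteq> S")
      case False
      then obtain i where "i \<in> U" "i \<notin> S" by auto
      then have "(\<Prod>i\<in>I-S. of_bool (i \<notin> U) :: real) = 0"
        using U finI by (intro prod_zero) auto
      with False show ?thesis by simp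
    qed (auto intro!: prod.neutral)
    finally show ?thesis .
  qed
  have "proj_sum (starred A) I (star_weight A m I) S c
      = (\<Sum>U\<in>Pow I. \<Sum>b\<in>Pi\<^sub>E I B. \<Sum>a\<in>Pi\<^sub>E U A. m U a * (\<Prod>i\<in>I. star_sign U a i (b i)))"
    unfolding proj_sum_def B star_weight_def by (rule sum.swap)
  also have "\<dots> = (\<Sum>U\<in>Pow I. \<Sum>a\<in>Pi\<^sub>E U A. m U a * (\<Sum>b\<in>Pi\<^sub>E I B. \<Prod>i\<in>I. star_sign U a i (b i)))"
    unfolding sum_distrib_left by (rule sum.cong[OF refl], rule sum.swap)
  also have "\<dots> = (\<Sum>U\<in>Pow I. of_bool (U \<subseteq> S) * (\<Sum>a\<in>Pi\<^sub>E U A. m U a * (\<Prod>i\<in>S. star_sign U a i (c i))))"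
  proof (rule sum.cong[OF refl])
    fix U assume "U \<in> Pow I"
    then have "(\<Sum>a\<in>Pi\<^sub>E U A. m U a * (\<Sum>b\<in>Pi\<^sub>E I B. \<Prod>i\<in>I. star_sign U a i (b i)))
        = (\<Sum>a\<in>Pi\<^sub>E U A. m U a * (of_bool (U \<subseteq> S) * (\<Prod>i\<in>S. star_sign U a i (c i))))"
      by (intro sum.cong refl arg_cong2[where f = "(*)"] prod) auto
    then show "(\<Sum>a\<in>Pi\<^sub>E U A. m U a * (\<Sum>b\<in>Pi\<^sub>E I B. \<Prod>i\<in>I. star_sign U a i (b i)))
        = of_bool (U \<subseteq> S) * (\<Sum>a\<in>Pi\<^sub>E U A. m U a * (\<Prod>i\<in>S. star_sign U a i (c i)))"
      by (simp add: sum_distrib_left mult.left_commute)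
  qed
  also have "\<dots> = star_weight A m S c"
    unfolding star_weight_def
    by (rule sum.mono_neutral_cong_right) (use SI finI in auto)
  finally show ?thesis .
qed

text \<open>The total mass is the marginal to the empty set of players, where only
  \<open>U = {}\<close> contributes.\<close>

lemma star_weight_total:
  "(\<Sum>b\<in>Pi\<^sub>E I (starred A). star_weight A m I b) = m {} (\<lambda>_. undefined)"
proof -
  have "(\<Sum>b\<in>Pi\<^sub>E I (starred A). star_weight A m I b)
      = proj_sum (starred A) I (star_weight A m I) {} (\<lambda>_. undefined)"
    unfolding proj_sum_def by (rule sum.cong) (auto simp: restrict_def)
  also have "\<dots> = star_weight A m {} (\<lambda>_. undefined)"
    by (rule proj_star_weight) auto
  finally show ?thesis by (simp add: star_weight_def)
qed

text \<open>Let \<open>T\<close> be the players without a star and \<open>c\<close> their answers.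
  The term \<open>U = T\<close> contributes \<open>m T c\<close>. The terms with larger
  \<open>U\<close> have total absolute value at most
  \<open>((1 + \<beta>)^card (I - T) - 1) * m T c\<close>, which is at most
  \<open>m T c\<close>.\<close>

lemma star_weight_nonneg:
  fixes \<beta> :: real
  assumes m: "\<And>S a. S \<subseteq> I \<Longrightarrow> a \<in> Pi\<^sub>E S A \<Longrightarrow> 0 \<le> m S a"
    and decay: "\<And>S T c. T \<subseteq> S \<Longrightarrow> S \<subseteq> I \<Longrightarrow> c \<in> Pi\<^sub>E T A \<Longrightarrow>
                  proj_sum A S (m S) T c \<le> \<beta> ^ card (S - T) * m T c"
    and \<beta>: "0 \<le> \<beta>" "(1 + \<beta>) ^ card I \<le> 2"
    and b: "b \<in> Pi\<^sub>E I (starred A)"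
  shows "0 \<le> star_weight A m I b"
proof -
  define T where "T = {i \<in> I. b i \<noteq> None}"
  define c where "c = (\<lambda>i\<in>T. the (b i))"
  define w where "w U = (\<Sum>a\<in>Pi\<^sub>E U A. m U a * (\<Prod>i\<in>I. star_sign U a i (b i)))" for U
  have TI: "T \<subseteq> I" by (auto simp: T_def)
  have c: "c \<in> Pi\<^sub>E T A"
    using PiE_mem[OF b] by (fastforce simp: c_def T_def)
  \<comment> \<open>The coefficients are 1, -1 or 0, and only tuples that extend \<open>c\<close>
    have a nonzero one.\<close>
  have sign: "\<bar>\<Prod>i\<in>I. star_sign U a i (b i)\<bar> \<le> of_bool (T \<subseteq> U \<and> restrict a T = c)" for U a
  proof (cases "T \<subseteq> U \<and> restrict a T = c")
    case True
    have "\<bar>\<Prod>i\<in>I. star_sign U a i (b i)\<bar> \<le> 1"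
      unfolding abs_prod by (rule prod_le_1) (auto simp: star_sign_def split: option.splits)
    with True show ?thesis by simp
  next
    case False
    then obtain i where i: "i \<in> T" "i \<notin> U \<or> a i \<noteq> the (b i)"
      by (auto simp: c_def fun_eq_iff split: if_splits)
    then have "star_sign U a i (b i) = 0" "i \<in> I"
      by (auto simp: star_sign_def T_def)
    then have "(\<Prod>i\<in>I. star_sign U a i (b i)) = 0"
      using finI by (intro prod_zero) auto
    with False show ?thesis by simp
  qed
  have w_le: "\<bar>w U\<bar> \<le> of_bool (T \<subseteq> U) * (\<beta> ^ card (U - T) * m T c)" if U: "U \<subseteq> I" for U
  proof -
    have "\<bar>w U\<bar> \<le> (\<Sum>a\<in>Pi\<^sub>E U A. \<bar>m U a * (\<Prod>i\<in>I. star_sign U a i (b i))\<bar>)"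
      unfolding w_def by (rule sum_abs)
    also have "\<dots> \<le> (\<Sum>a\<in>Pi\<^sub>E U A. m U a * of_bool (T \<subseteq> U \<and> restrict a T = c))"
      unfolding abs_mult using sign m[OF U] by (intro sum_mono mult_mono) auto
    also have "\<dots> = of_bool (T \<subseteq> U) * proj_sum A U (m U) T c"
      unfolding proj_sum_def using fin_PiE[OF U]
      by (simp add: sum.inter_filter of_bool_conj of_bool_def if_distrib cong: if_cong)
    also have "\<dots> \<le> of_bool (T \<subseteq> U) * (\<beta> ^ card (U - T) * m T c)"
      using decay[OF _ U c] by (cases "T \<subseteq> U") auto
    finally show ?thesis .
  qed
  have w_T: "w T = m T c"
  proof -
    have "w T = (\<Sum>a\<in>Pi\<^sub>E T A. if a = c then m T a else 0)"
      unfolding w_def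
    proof (rule sum.cong[OF refl])
      fix a assume a: "a \<in> Pi\<^sub>E T A"
      show "m T a * (\<Prod>i\<in>I. star_sign T a i (b i)) = (if a = c then m T a else 0)"
      proof (cases "a = c")
        case True
        then have "(\<Prod>i\<in>I. star_sign T a i (b i)) = 1"
          by (intro prod.neutral) (auto simp: star_sign_def T_def c_def)
        with True show ?thesis by simp
      next
        case False
        then have "restrict a T \<noteq> c" using a by (simp add: PiE_restrict)
        then show ?thesis using sign[of T a] False by simp
      qed
    qed
    then show ?thesis using c fin_PiE[OF TI] by simp
  qed
  have "m T c * (\<Sum>V\<in>Pow (I - T) - {{}}. \<beta> ^ card V) \<le> m T c * 1"
  proof (rule mult_left_mono)
    \<comment> \<open>By the binomial theorem the sum is \<open>(1 + \<beta>)^card (I - T)\<close>;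
      the empty set accounts for 1 of it.\<close>
    have "(\<Sum>V\<in>Pow (I - T). \<beta> ^ card V) \<le> 2"
      using power_increasing[of "card (I - T)" "card I" "1 + \<beta>"] \<beta> finI
      by (simp add: sum_power_card_Pow card_mono)
    then show "(\<Sum>V\<in>Pow (I - T) - {{}}. \<beta> ^ card V) \<le> 1"
      using finI by (simp add: sum_diff)
  qed (use m[OF TI c] in simp)
  moreover have "(\<Sum>U\<in>Pow I - {T}. \<bar>w U\<bar>) \<le> m T c * (\<Sum>V\<in>Pow (I - T) - {{}}. \<beta> ^ card V)"
  proof -
    have "(\<Sum>U\<in>Pow I - {T}. \<bar>w U\<bar>)
        \<le> (\<Sum>U\<in>Pow I - {T}. of_bool (T \<subseteq> U) * (\<beta> ^ card (U - T) * m T c))"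
      using w_le by (intro sum_mono) auto
    also have "\<dots> = (\<Sum>U\<in>{U. T \<subset> U \<and> U \<subseteq> I}. \<beta> ^ card (U - T) * m T c)"
      by (rule sum.mono_neutral_cong_right) (use finI in auto)
    also have "\<dots> = (\<Sum>V\<in>Pow (I - T) - {{}}. \<beta> ^ card V * m T c)"
      by (rule sum.reindex_bij_witness[of _ "\<lambda>V. T \<union> V" "\<lambda>U. U - T"])
        (use TI in \<open>auto simp: Un_absorb1 Diff_triv Int_commute intro!: arg_cong[where f = card] arg_cong[where f = "\<lambda>n. \<beta> ^ n"]\<close>)
    finally show ?thesis by (simp only: sum_distrib_left mult.commute)
  qed
  moreover have "star_weight A m I b = m T c + (\<Sum>U\<in>Pow I - {T}. w U)"
  proof -
    have "star_weight A m I b = (\<Sum>U\<in>Pow I. w U)"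
      by (simp add: star_weight_def w_def)
    also have "\<dots> = w T + (\<Sum>U\<in>Pow I - {T}. w U)"
      using TI finI by (intro sum.remove) auto
    finally show ?thesis by (simp only: w_T)
  qed
  moreover have "\<bar>\<Sum>U\<in>Pow I - {T}. w U\<bar> \<le> (\<Sum>U\<in>Pow I - {T}. \<bar>w U\<bar>)"
    by (rule sum_abs)
  ultimately show ?thesis by linarith
qed

text \<open>Without stars, a player outside \<open>U\<close> contributes the factor 0, so only
  \<open>U = I\<close> and \<open>a = c\<close> remain.\<close>

lemma star_weight_no_star:
  assumes c: "c \<in> Pi\<^sub>E I A"
  shows "star_weight A m I (\<lambda>i\<in>I. Some (c i)) = m I c"
proof -
  have "(\<Sum>a\<in>Pi\<^sub>E U A. m U a * (\<Prod>i\<in>I. star_sign U a i (Some (c i))))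
      = (if U = I then m I c else 0)" if U: "U \<subseteq> I" for U
  proof (cases "U = I")
    case True
    have "(\<Prod>i\<in>I. star_sign U a i (Some (c i))) = (if a = c then 1 else 0)"
      if "a \<in> Pi\<^sub>E I A" for a
    proof (cases "a = c")
      case False
      then have "\<exists>i\<in>I. c i \<noteq> a i"
        using PiE_ext[OF \<open>a \<in> Pi\<^sub>E I A\<close> c] by fastforce
      then obtain i where "i \<in> I" "c i \<noteq> a i" by blast
      then have "(\<Prod>i\<in>I. star_sign U a i (Some (c i))) = 0"
        using finI by (intro prod_zero) (auto simp: star_sign_def True)
      with False show ?thesis by simp
    qed (auto intro!: prod.neutral simp: star_sign_def True)
    then have "(\<Sum>a\<in>Pi\<^sub>E I A. m I a * (\<Prod>i\<in>I. star_sign U a i (Some (c i))))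
        = (\<Sum>a\<in>Pi\<^sub>E I A. if a = c then m I a else 0)"
      by (intro sum.cong) auto
    then show ?thesis using True c fin_PiE[of I] by simp
  next
    case False
    then obtain i where "i \<in> I" "i \<notin> U" using U by auto
    then have "(\<Prod>i\<in>I. star_sign U a i (Some (c i))) = 0" for a
      using finI by (intro prod_zero) (auto simp: star_sign_def)
    with False show ?thesis by simp
  qed
  then have "star_weight A m I (\<lambda>i\<in>I. Some (c i)) = (\<Sum>U\<in>Pow I. if U = I then m I c else 0)"
    unfolding star_weight_def by (intro sum.cong) auto
  then show ?thesis using finI by simp
qed

end

section \<open>Star games\<close>

lemma finite_pmf_exists:
  assumes "finite X" "\<And>x. x \<in> X \<Longrightarrow> 0 \<le> f x" "sum f X = 1"
  shows "\<exists>D. set_pmf D \<subseteq> X \<and> (\<forall>x\<in>X. pmf D x = f x)"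
proof -
  let ?g = "\<lambda>x. if x \<in> X then f x else 0"
  have nn: "0 \<le> ?g x" for x using assms(2) by simp
  have "(\<integral>\<^sup>+x. ennreal (?g x) \<partial>count_space UNIV) = (\<integral>\<^sup>+x. ennreal (f x) \<partial>count_space X)"
    by (subst nn_integral_count_space_indicator)
      (auto intro!: nn_integral_cong simp: indicator_def)
  also have "\<dots> = ennreal (sum f X)"
    using assms by (simp add: nn_integral_count_space_finite sum_ennreal)
  finally have one: "(\<integral>\<^sup>+x. ennreal (?g x) \<partial>count_space UNIV) = 1"
    using assms(3) by simp
  have "pmf (embed_pmf ?g) x = ?g x" for x
    by (rule pmf_embed_pmf[OF nn one])
  then show ?thesis
    by (intro exI[of _ "embed_pmf ?g"]) (auto simp: set_pmf_iff split: if_splits)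
qed

lemma pmf_map_finite:
  assumes "finite X" "set_pmf D \<subseteq> X"
  shows "pmf (map_pmf f D) y = (\<Sum>x\<in>{x \<in> X. f x = y}. pmf D x)"
proof -
  have "pmf (map_pmf f D) y = measure D (f -` {y})" by (rule pmf_map)
  also have "\<dots> = measure D {x \<in> X. f x = y}"
    using assms(2) by (intro measure_pmf.finite_measure_eq_AE) (auto simp: AE_measure_pmf_iff)
  finally show ?thesis using assms(1) by (simp add: measure_measure_pmf_finite)
qed

text \<open>Lets the slack \<open>\<theta>\<close> of near-optimal strategies tend to 0, so that no
  strategy attaining the supremum has to be exhibited.\<close>

lemma le_of_le_add_scaled:
  fixes u v w :: real
  assumes "\<And>\<theta>. \<theta> > 0 \<Longrightarrow> u - \<theta> * w \<le> v" "w \<ge> 0"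
  shows "u \<le> v"
proof (rule field_le_epsilon)
  fix e :: real assume "e > 0"
  \<comment> \<open>Dividing by \<open>w + 1\<close> keeps the chosen slack positive even for
    \<open>w = 0\<close>.\<close>
  have "e / (w + 1) * w \<le> e"
    using assms(2) \<open>e > 0\<close> by (simp add: field_simps)
  moreover have "u - e / (w + 1) * w \<le> v"
    by (rule assms(1)) (use assms(2) \<open>e > 0\<close> in simp)
  ultimately show "u \<le> v + e" by linarith
qed

text \<open>From \<open>1 + x \<le> exp x\<close> the power is at most \<open>exp (1 / k^2)\<close>,
  which suffices for \<open>k \<ge> 2\<close>. For \<open>k = 1\<close> equality holds, and for
  \<open>k = 0\<close> the power is 1.\<close>

lemma inverse_cube_power_le_2: "(1 + 1 / real k ^ 3) ^ k \<le> 2"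
proof (cases "k \<le> 1")
  case True
  then have "k = 0 \<or> k = 1" by auto
  then show ?thesis by auto
next
  case False
  have "(1 + 1 / real k ^ 3) ^ k \<le> exp (1 / real k ^ 3) ^ k"
    by (intro power_mono exp_ge_add_one_self) auto
  also have "\<dots> = exp (1 / real k ^ 2)"
    using False by (simp add: exp_of_nat_mult[symmetric] power3_eq_cube power2_eq_square)
  also have "\<dots> \<le> 2"
  proof -
    have "2 * 1 \<le> real k * real k" using False by (intro mult_mono) auto
    then have "1 / real k ^ 2 \<le> 1 / 2" using False by (simp add: power2_eq_square field_simps)
    then have "norm (1 / real k ^ 2) \<le> 1 / 2" by simp
    then have "norm (exp (1 / real k ^ 2)) \<le> 2" by (rule exp_bound_half)
    then show ?thesis by simp
  qed
  finally show ?thesis .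
qed

section \<open>Strategy classes and winning probabilities of finite games\<close>

lemma finite_qtuples: "is_game k G \<Longrightarrow> S \<subseteq> {1..k} \<Longrightarrow> finite (qtuples G S)"
  unfolding qtuples_def by (rule finite_PiE_subset[of "{1..k}"]) (auto simp: is_game_def)

lemma finite_atuples: "is_game k G \<Longrightarrow> S \<subseteq> {1..k} \<Longrightarrow> finite (atuples G S)"
  unfolding atuples_def by (rule finite_PiE_subset[of "{1..k}"]) (auto simp: is_game_def)

lemma ex_atuple: "is_game k G \<Longrightarrow> \<exists>a. a \<in> atuples G {1..k}"
  unfolding atuples_def is_game_def by (metis PiE_eq_empty_iff all_not_in_conv)

lemma qdist_subset: "is_game k G \<Longrightarrow> set_pmf (qdist G) \<subseteq> qtuples G {1..k}"
  by (simp add: is_game_def)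

lemma restrict_qtuples: "q \<in> qtuples G T \<Longrightarrow> S \<subseteq> T \<Longrightarrow> restrict q S \<in> qtuples G S"
  unfolding qtuples_def by (rule restrict_in_PiE)

lemma restrict_atuples: "a \<in> atuples G T \<Longrightarrow> S \<subseteq> T \<Longrightarrow> restrict a S \<in> atuples G S"
  unfolding atuples_def by (rule restrict_in_PiE)

lemma marg_eq_proj_sum:
  "marg k G p q S a = proj_sum (answers G) {1..k} (\<lambda>b. pmf (p q) (Some b)) S a"
  by (simp add: marg_def proj_sum_def atuples_def)

text \<open>Treats \<open>NS\<close> and \<open>hrNS\<close> uniformly, so that one construction of
  a strategy serves both halves of the theorem.\<close>

definition consistent_on ::
  "nat \<Rightarrow> ('q, 'a) game \<Rightarrow> (nat \<Rightarrow> 'q) set \<Rightarrow> ('q, 'a) strategy set" where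
  "consistent_on k G R = {p. is_strategy k G p \<and>
     (\<exists>Sim. is_sim k G Sim \<and>
        (\<forall>q\<in>R. \<forall>S\<subseteq>{1..k}. \<forall>a\<in>atuples G S. marg k G p q S a = pmf (Sim S (restrict q S)) a))}"

lemma NS_eq: "NS k G = consistent_on k G (qtuples G {1..k})"
  by (simp add: NS_def consistent_on_def)

lemma hrNS_eq: "hrNS k G = consistent_on k G (set_pmf (qdist G))"
  by (simp add: hrNS_def consistent_on_def)

text \<open>Provides nonemptiness of the strategy classes, without which their supremum says
  nothing, and an explicit strategy for a question distribution concentrated at one point.\<close>

lemma constant_in_NS:
  assumes G: "is_game k G" and a: "a \<in> atuples G {1..k}"
  shows "(\<lambda>_. return_pmf (Some a)) \<in> NS k G"
proof -
  have "marg k G (\<lambda>_. return_pmf (Some a)) q S c = pmf (return_pmf (restrict a S)) c"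
    for q :: "nat \<Rightarrow> 'a" and S c
  proof -
    have "marg k G (\<lambda>_. return_pmf (Some a)) q S c
        = (\<Sum>b\<in>{b \<in> atuples G {1..k}. restrict b S = c}. if b = a then 1 else 0)"
      unfolding marg_def by (rule sum.cong) (auto simp: indicator_def)
    then show ?thesis
      using a finite_atuples[OF G, of "{1..k}"] by (auto simp: indicator_def)
  qed
  moreover have "is_strategy k G (\<lambda>_. return_pmf (Some a))"
    using a by (simp add: is_strategy_def)
  moreover have "is_sim k G (\<lambda>S _. return_pmf (restrict a S))"
    using restrict_atuples[OF a] by (simp add: is_sim_def)
  ultimately show ?thesis unfolding NS_def by blast
qed

lemma NS_subset_subNS: "NS k G \<subseteq> subNS k G"
  unfolding NS_def subNS_def by (auto intro: eq_refl)

definition win_at :: "nat \<Rightarrow> ('q, 'a) game \<Rightarrow> ('q, 'a) strategy \<Rightarrow> (nat \<Rightarrow> 'q) \<Rightarrow> real" where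
  "win_at k G p q = (\<Sum>a\<in>atuples G {1..k}. pmf (p q) (Some a) * of_bool (accepts G q a))"

lemma win_prob_eq:
  "win_prob k G p = (\<Sum>q\<in>qtuples G {1..k}. pmf (qdist G) q * win_at k G p q)"
  by (simp add: win_prob_def win_at_def)

lemma win_at_nonneg: "0 \<le> win_at k G p q"
  unfolding win_at_def by (intro sum_nonneg) auto

lemma win_at_le:
  assumes G: "is_game k G"
  shows "win_at k G p q \<le> 1 - pmf (p q) None"
proof -
  let ?X = "atuples G {1..k}"
  have fin: "finite ?X" by (rule finite_atuples[OF G]) simp
  have "win_at k G p q + pmf (p q) None \<le> (\<Sum>a\<in>?X. pmf (p q) (Some a)) + pmf (p q) None"
    unfolding win_at_def by (intro add_right_mono sum_mono) auto
  also have "\<dots> = (\<Sum>x\<in>insert None (Some ` ?X). pmf (p q) x)"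
    using fin by (subst sum.insert) (auto simp: sum.reindex)
  also have "\<dots> = measure (p q) (insert None (Some ` ?X))"
    using fin by (simp add: measure_measure_pmf_finite)
  also have "\<dots> \<le> 1" by simp
  finally show ?thesis by simp
qed

lemma sum_qdist: "is_game k G \<Longrightarrow> (\<Sum>q\<in>qtuples G {1..k}. pmf (qdist G) q) = 1"
  by (intro sum_pmf_eq_1 finite_qtuples qdist_subset) auto

lemma win_prob_ge:
  assumes G: "is_game k G" and v: "\<And>q. q \<in> set_pmf (qdist G) \<Longrightarrow> v \<le> win_at k G p q"
  shows "v \<le> win_prob k G p"
proof -
  have "v = (\<Sum>q\<in>qtuples G {1..k}. pmf (qdist G) q * v)"
    by (simp add: sum_distrib_right[symmetric] sum_qdist[OF G] del: One_nat_def)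
  also have "\<dots> \<le> win_prob k G p"
    unfolding win_prob_eq
  proof (rule sum_mono)
    fix q show "pmf (qdist G) q * v \<le> pmf (qdist G) q * win_at k G p q"
      using v[of q] by (cases "q \<in> set_pmf (qdist G)") (auto simp: set_pmf_iff intro: mult_left_mono)
  qed
  finally show ?thesis .
qed

lemma win_prob_le_1:
  assumes G: "is_game k G"
  shows "win_prob k G p \<le> 1"
proof -
  have "win_prob k G p \<le> (\<Sum>q\<in>qtuples G {1..k}. pmf (qdist G) q * 1)"
    unfolding win_prob_eq
  proof (intro sum_mono mult_left_mono)
    fix q show "win_at k G p q \<le> 1"
      using win_at_le[OF G, of p q] pmf_nonneg[of "p q" None] by linarith
  qed simp
  then show ?thesis by (simp add: sum_qdist[OF G] del: One_nat_def)
qed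

lemma win_prob_le_game_value:
  assumes "is_game k G" "p \<in> C"
  shows "win_prob k G p \<le> game_value k G C"
  unfolding game_value_def using assms
  by (intro cSUP_upper bdd_aboveI2[of _ _ 1] win_prob_le_1)

lemma ex_near_optimal:
  assumes "is_game k G" "C \<noteq> {}" "v \<le> game_value k G C" "\<theta> > 0"
  shows "\<exists>p\<in>C. v - \<theta> < win_prob k G p"
proof -
  have "v - \<theta> < (SUP p\<in>C. win_prob k G p)"
    using assms(3,4) by (simp add: game_value_def)
  then show ?thesis
    using assms by (subst (asm) less_cSUP_iff) (auto intro!: bdd_aboveI2[of _ _ 1] win_prob_le_1)
qed

section \<open>The canonical star game and its strategies\<close>

definition star_of ::
  "nat \<Rightarrow> ('q, 'a) game \<Rightarrow> (nat \<Rightarrow> 'q) pmf \<Rightarrow> ('q, 'a option) game" where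
  "star_of k G \<pi> = \<lparr>questions = questions G, answers = starred (answers G),
     accepts = (\<lambda>q b. \<exists>a\<in>atuples G {1..k}. b = embed_answers k a \<and> accepts G q a), qdist = \<pi>\<rparr>"

lemma embed_answers_inj: "inj_on (embed_answers k) (atuples G {1..k})"
proof (rule inj_onI)
  fix a b assume ab: "a \<in> atuples G {1..k}" "b \<in> atuples G {1..k}"
    and eq: "embed_answers k a = embed_answers k b"
  have "a i = b i" if "i \<in> {1..k}" for i
    using fun_cong[OF eq, of i] that by (simp add: embed_answers_def)
  then show "a = b" by (rule PiE_ext[OF ab[unfolded atuples_def]])
qed

lemma embed_answers_in: "a \<in> atuples G {1..k} \<Longrightarrow> embed_answers k a \<in> atuples (star_of k G \<pi>) {1..k}"
  by (auto simp: embed_answers_def atuples_def star_of_def PiE_iff)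

lemma star_of_simps [simp]:
  "qtuples (star_of k G \<pi>) S = qtuples G S"
  "qdist (star_of k G \<pi>) = \<pi>"
  "answers (star_of k G \<pi>) = starred (answers G)"
  "atuples (star_of k G \<pi>) S = Pi\<^sub>E S (starred (answers G))"
  by (simp_all add: star_of_def qtuples_def atuples_def)

lemma accepts_star_of:
  "a \<in> atuples G {1..k} \<Longrightarrow> accepts (star_of k G \<pi>) q (embed_answers k a) \<longleftrightarrow> accepts G q a"
  using inj_onD[OF embed_answers_inj] by (auto simp: star_of_def)

lemma star_game_star_of:
  assumes "is_game k G" "set_pmf \<pi> \<subseteq> qtuples G {1..k}"
  shows "star_game k G (star_of k G \<pi>)"
  using assms accepts_star_of[of _ G k \<pi>] unfolding star_game_def
  by (auto simp: is_game_def) (auto simp: star_of_def)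

lemma win_at_star_of:
  assumes G: "is_game k G"
  shows "win_at k (star_of k G \<pi>) P q
    = (\<Sum>a\<in>atuples G {1..k}. pmf (P q) (Some (embed_answers k a)) * of_bool (accepts G q a))"
proof -
  let ?H = "star_of k G \<pi>"
  have fin: "finite (atuples ?H {1..k})"
    using G by (auto simp: is_game_def intro!: finite_PiE)
  have "win_at k ?H P q = (\<Sum>b\<in>embed_answers k ` atuples G {1..k}.
      pmf (P q) (Some b) * of_bool (accepts ?H q b))"
    unfolding win_at_def
  proof (rule sum.mono_neutral_right[OF fin])
    show "embed_answers k ` atuples G {1..k} \<subseteq> atuples ?H {1..k}"
      using embed_answers_in by blast
  qed (auto simp: star_of_def)
  also have "\<dots> = (\<Sum>a\<in>atuples G {1..k}. pmf (P q) (Some (embed_answers k a)) * of_bool (accepts G q a))"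
    by (subst sum.reindex[OF embed_answers_inj]) (simp add: accepts_star_of)
  finally show ?thesis .
qed

text \<open>The strategy draws its answers from the inclusion-exclusion weights of the scaled
  trimmed family. Accepted tuples carry no star, so each has weight \<open>\<beta>^k * h\<close>,
  where \<open>\<beta>^k = 1 / k^(3k)\<close>, and passing from \<open>p\<close> to \<open>h\<close>
  costs at most \<open>(k^k - 1) * \<eta>\<close>. The set \<open>R\<close> will be all question
  tuples or the support of a conditioned distribution.\<close>

lemma star_strategy_exists:
  fixes G :: "('q, 'a) game"
  assumes G: "is_game k G" and R: "R \<subseteq> qtuples G {1..k}" and p: "p \<in> subNS k G"
    and \<eta>: "\<And>q. q \<in> R \<Longrightarrow> pmf (p q) None \<le> \<eta>"
  shows "\<exists>P\<in>consistent_on k (star_of k G \<pi>) R. \<forall>q\<in>R.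
    1 / real k ^ (3 * k) * (win_at k G p q - (real k ^ k - 1) * \<eta>) \<le> win_at k (star_of k G \<pi>) P q"
proof -
  let ?I = "{1..k}" and ?A = "answers G" and ?H = "star_of k G \<pi>"
  let ?\<beta> = "1 / real k ^ 3"
  let ?X = "Pi\<^sub>E ?I (starred ?A)"
  from p obtain Sim where strat: "is_strategy k G p" and Sim: "is_sim k G Sim"
    and le: "\<And>q S a. q \<in> qtuples G ?I \<Longrightarrow> S \<subseteq> ?I \<Longrightarrow> a \<in> atuples G S \<Longrightarrow>
       marg k G p q S a \<le> pmf (Sim S (restrict q S)) a"
    unfolding subNS_def by blast
  define \<sigma> where "\<sigma> q S = pmf (Sim S (restrict q S))" for q S
  define m where "m q S = (\<lambda>a. ?\<beta> ^ card S * trimmed ?A (\<sigma> q) S a)" for q S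
  interpret finite_alphabets ?I ?A
    using G by unfold_locales (auto simp: is_game_def)
  have finX: "finite ?X"
    using G by (auto simp: is_game_def intro!: finite_PiE)
  have family: "overlapping_family ?I ?A (\<sigma> q) (\<lambda>a. pmf (p q) (Some a)) \<eta>" if q: "q \<in> R" for q
  proof unfold_locales
    fix S assume S: "S \<subseteq> ?I"
    have "set_pmf (Sim S (restrict q S)) \<subseteq> Pi\<^sub>E S ?A"
      using Sim S restrict_qtuples[of q G ?I S] q R unfolding is_sim_def atuples_def by blast
    then show "(\<Sum>a\<in>Pi\<^sub>E S ?A. \<sigma> q S a) = 1"
      unfolding \<sigma>_def by (intro sum_pmf_eq_1 fin_PiE S)
  next
    fix S a assume "S \<subseteq> ?I" "a \<in> Pi\<^sub>E S ?A"
    then show "proj_sum ?A ?I (\<lambda>a. pmf (p q) (Some a)) S a \<le> \<sigma> q S a"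
      using le[of q S a] q R by (auto simp: marg_eq_proj_sum \<sigma>_def atuples_def)
  next
    have "set_pmf (p q) \<subseteq> insert None (Some ` Pi\<^sub>E ?I ?A)"
      using strat q R unfolding is_strategy_def atuples_def by blast
    then have "(\<Sum>x\<in>insert None (Some ` Pi\<^sub>E ?I ?A). pmf (p q) x) = 1"
      using fin_PiE[of ?I] by (intro sum_pmf_eq_1) auto
    also have "(\<Sum>x\<in>insert None (Some ` Pi\<^sub>E ?I ?A). pmf (p q) x)
        = pmf (p q) None + (\<Sum>a\<in>Pi\<^sub>E ?I ?A. pmf (p q) (Some a))"
      using fin_PiE[of ?I] by (subst sum.insert) (auto simp: sum.reindex)
    finally show "1 - \<eta> \<le> (\<Sum>a\<in>Pi\<^sub>E ?I ?A. pmf (p q) (Some a))"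
      using \<eta>[OF q] by simp
  qed (auto simp: \<sigma>_def)
  have "\<exists>D. set_pmf D \<subseteq> ?X \<and> (\<forall>b\<in>?X. pmf D b = star_weight ?A (m q) ?I b)" if q: "q \<in> R" for q
  proof -
    interpret overlapping_family ?I ?A "\<sigma> q" "\<lambda>a. pmf (p q) (Some a)" \<eta>
      by (rule family[OF q])
    show ?thesis
    proof (rule finite_pmf_exists[OF finX])
      fix b assume b: "b \<in> ?X"
      show "0 \<le> star_weight ?A (m q) ?I b"
      proof (rule star_weight_nonneg[OF _ _ _ _ b])
        show "0 \<le> m q S a" if "S \<subseteq> ?I" "a \<in> Pi\<^sub>E S ?A" for S a
          using h_nonneg[OF that] by (simp add: m_def del: One_nat_def)
        show "(1 + ?\<beta>) ^ card ?I \<le> 2" using inverse_cube_power_le_2[of k] by simp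
      next
        fix S T c assume T: "T \<subseteq> S" and S: "S \<subseteq> ?I" and c: "c \<in> Pi\<^sub>E T ?A"
        \<comment> \<open>Splitting the power of \<open>\<beta>\<close> accordingly turns the
          monotonicity of \<open>h\<close> into the decay that nonnegativity of the weights
          requires.\<close>
        have "card S = card (S - T) + card T"
          using card_Diff_subset[OF _ T] card_mono[OF finite_sub[OF S] T] finite_sub[OF S] T
          by (simp add: finite_subset)
        moreover have "proj_sum ?A S (m q S) T c = ?\<beta> ^ card S * proj_sum ?A S (h S) T c"
          by (simp add: proj_sum_def m_def sum_distrib_left)
        ultimately have "proj_sum ?A S (m q S) T c
            = ?\<beta> ^ card (S - T) * (?\<beta> ^ card T * proj_sum ?A S (h S) T c)"
          by (simp only: power_add mult.assoc)
        also have "\<dots> \<le> ?\<beta> ^ card (S - T) * (?\<beta> ^ card T * h T c)"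
          by (intro mult_left_mono proj_h_le T S c) auto
        finally show "proj_sum ?A S (m q S) T c \<le> ?\<beta> ^ card (S - T) * m q T c"
          by (simp add: m_def)
      qed simp
    next
      \<comment> \<open>The total is \<open>m q {}\<close>, which is \<open>\<sigma> q {}\<close>
        with the factor \<open>\<beta>^0 = 1\<close>, hence 1.\<close>
      show "(\<Sum>b\<in>?X. star_weight ?A (m q) ?I b) = 1"
        using \<sigma>_total[of "{}"] by (simp add: star_weight_total m_def trimmed_empty del: One_nat_def)
    qed
  qed
  then obtain D where D: "\<And>q. q \<in> R \<Longrightarrow> set_pmf (D q) \<subseteq> ?X"
    and pmf_D: "\<And>q b. q \<in> R \<Longrightarrow> b \<in> ?X \<Longrightarrow> pmf (D q) b = star_weight ?A (m q) ?I b"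
    by metis
  obtain a0 where "a0 \<in> atuples G ?I" using ex_atuple[OF G] by blast
  then have b0: "embed_answers k a0 \<in> ?X" using embed_answers_in[of a0 G k \<pi>] by simp
  define P where
    "P q = (if q \<in> R then map_pmf Some (D q) else return_pmf (Some (embed_answers k a0)))" for q
  have pmf_P: "pmf (P q) (Some b) = star_weight ?A (m q) ?I b" if "q \<in> R" "b \<in> ?X" for q b
    using pmf_D[OF that] that(1) by (simp add: P_def pmf_map_inj')
  have marg_P: "proj_sum (starred ?A) ?I (pmf (D q)) S c = star_weight ?A (m q) S c"
    if q: "q \<in> R" and S: "S \<subseteq> ?I" and c: "c \<in> Pi\<^sub>E S (starred ?A)" for q S c
  proof -
    have "proj_sum (starred ?A) ?I (pmf (D q)) S c
        = proj_sum (starred ?A) ?I (star_weight ?A (m q) ?I) S c"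
      unfolding proj_sum_def using pmf_D[OF q] by (intro sum.cong) auto
    then show ?thesis by (simp only: proj_star_weight[OF S c])
  qed
  \<comment> \<open>The source of non-signaling: the marginal weights at \<open>S\<close> see
    \<open>q\<close> only through its restriction to \<open>S\<close>.\<close>
  have local: "star_weight ?A (m q) S c = star_weight ?A (m q') S c"
    if eq: "restrict q S = restrict q' S" for q q' S c
  proof (rule star_weight_cong)
    fix T assume T: "T \<subseteq> S"
    have "\<sigma> q U = \<sigma> q' U" if "U \<subseteq> T" for U
    proof -
      have "restrict (restrict q S) U = restrict (restrict q' S) U" using eq by simp
      then have "restrict q U = restrict q' U"
        using that T by (simp add: restrict_restrict Int_absorb1)
      then show ?thesis by (simp add: \<sigma>_def)
    qed
    then have "trimmed ?A (\<sigma> q) T = trimmed ?A (\<sigma> q') T" by (rule trimmed_cong)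
    then show "m q T = m q' T" by (simp add: m_def)
  qed
  \<comment> \<open>The simulator for questions \<open>x\<close> of \<open>S\<close> plays the
    strategy at some tuple in \<open>R\<close> that extends \<open>x\<close>. By
    \<open>local\<close> the choice of the extension does not matter; if there is none, any fixed
    answer will do.\<close>
  define rep where "rep S x = (SOME q. q \<in> R \<and> restrict q S = x)" for S x
  define Sim' where "Sim' S x = (if \<exists>q\<in>R. restrict q S = x
      then map_pmf (\<lambda>b. restrict b S) (D (rep S x)) else return_pmf (restrict (embed_answers k a0) S))" for S x
  have rep: "rep S (restrict q S) \<in> R \<and> restrict (rep S (restrict q S)) S = restrict q S"
    if "q \<in> R" for q S
    unfolding rep_def by (rule someI[of _ q]) (use that in simp)
  have "P \<in> consistent_on k ?H R"
    unfolding consistent_on_def mem_Collect_eq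
  proof (intro conjI exI[of _ Sim'] ballI allI impI)
    show "is_strategy k ?H P"
      unfolding is_strategy_def star_of_simps
    proof
      fix q show "set_pmf (P q) \<subseteq> insert None (Some ` ?X)"
        using D[of q] b0 by (cases "q \<in> R") (auto simp: P_def)
    qed
    show "is_sim k ?H Sim'"
      unfolding is_sim_def
    proof (intro allI impI ballI)
      fix S x assume S: "S \<subseteq> ?I"
      have sub: "restrict b S \<in> Pi\<^sub>E S (starred ?A)" if "b \<in> ?X" for b
        by (rule restrict_in_PiE[OF that S])
      show "set_pmf (Sim' S x) \<subseteq> atuples ?H S"
      proof (cases "\<exists>q\<in>R. restrict q S = x")
        case True
        then have "rep S x \<in> R" using rep by blast
        then have "(\<lambda>b. restrict b S) ` set_pmf (D (rep S x)) \<subseteq> Pi\<^sub>E S (starred ?A)"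
          by (intro image_subsetI sub subsetD[OF D])
        with True show ?thesis by (simp add: Sim'_def)
      next
        case False
        with sub[OF b0] show ?thesis by (simp add: Sim'_def)
      qed
    qed
    fix q S c assume q: "q \<in> R" and S: "S \<subseteq> ?I" and c: "c \<in> atuples ?H S"
    have c': "c \<in> Pi\<^sub>E S (starred ?A)" using c by simp
    have "marg k ?H P q S c = star_weight ?A (m q) S c"
      using marg_P[OF q S c'] q by (simp add: marg_eq_proj_sum P_def pmf_map_inj')
    also have "\<dots> = star_weight ?A (m (rep S (restrict q S))) S c"
      by (rule local) (use rep[OF q] in simp)
    also have "\<dots> = pmf (map_pmf (\<lambda>b. restrict b S) (D (rep S (restrict q S)))) c"
      using marg_P[of "rep S (restrict q S)" S c] rep[OF q] S c' D finX
      by (subst pmf_map_finite[of ?X]) (auto simp: proj_sum_def)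
    also have "\<dots> = pmf (Sim' S (restrict q S)) c"
      using q by (auto simp: Sim'_def)
    finally show "marg k ?H P q S c = pmf (Sim' S (restrict q S)) c" .
  qed
  moreover have "1 / real k ^ (3 * k) * (win_at k G p q - (real k ^ k - 1) * \<eta>) \<le> win_at k ?H P q"
    if q: "q \<in> R" for q
  proof -
    interpret overlapping_family ?I ?A "\<sigma> q" "\<lambda>a. pmf (p q) (Some a)" \<eta>
      by (rule family[OF q])
    have pow: "?\<beta> ^ k = 1 / real k ^ (3 * k)" by (simp add: power_divide power_mult)
    have "win_at k G p q - (\<Sum>a\<in>Pi\<^sub>E ?I ?A. \<sigma> q ?I a - h ?I a)
        = (\<Sum>a\<in>Pi\<^sub>E ?I ?A. pmf (p q) (Some a) * of_bool (accepts G q a) - (\<sigma> q ?I a - h ?I a))"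
      by (simp add: win_at_def atuples_def sum_subtractf)
    \<comment> \<open>For accepted \<open>a\<close> this is \<open>p \<le> \<sigma>\<close>; for
      rejected \<open>a\<close> it is \<open>h \<le> \<sigma>\<close>.\<close>
    also have "\<dots> \<le> (\<Sum>a\<in>Pi\<^sub>E ?I ?A. h ?I a * of_bool (accepts G q a))"
    proof (rule sum_mono)
      fix a assume a: "a \<in> Pi\<^sub>E ?I ?A"
      show "pmf (p q) (Some a) * of_bool (accepts G q a) - (\<sigma> q ?I a - h ?I a)
          \<le> h ?I a * of_bool (accepts G q a)"
        using h_le_\<sigma>[OF _ a] p_le[OF _ a] a by (simp add: proj_sum_same)
    qed
    finally have "win_at k G p q - (real k ^ k - 1) * \<eta>
        \<le> (\<Sum>a\<in>Pi\<^sub>E ?I ?A. h ?I a * of_bool (accepts G q a))"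
      using loss_le[of ?I] by simp
    then have "?\<beta> ^ k * (win_at k G p q - (real k ^ k - 1) * \<eta>)
        \<le> ?\<beta> ^ k * (\<Sum>a\<in>Pi\<^sub>E ?I ?A. h ?I a * of_bool (accepts G q a))"
      by (rule mult_left_mono) simp
    also have "\<dots> = (\<Sum>a\<in>Pi\<^sub>E ?I ?A. m q ?I a * of_bool (accepts G q a))"
      by (simp add: m_def sum_distrib_left mult.assoc)
    also have "\<dots> = win_at k ?H P q"
      unfolding win_at_star_of[OF G] atuples_def
    proof (rule sum.cong[OF refl])
      fix a assume a: "a \<in> Pi\<^sub>E ?I ?A"
      have "embed_answers k a \<in> ?X"
        using embed_answers_in[of a G k \<pi>] a by (simp add: atuples_def)
      then have "pmf (P q) (Some (embed_answers k a)) = m q ?I a"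
        using pmf_P[OF q] star_weight_no_star[OF a] by (simp add: embed_answers_def)
      then show "m q ?I a * of_bool (accepts G q a)
          = pmf (P q) (Some (embed_answers k a)) * of_bool (accepts G q a)" by simp
    qed
    finally show ?thesis unfolding pow .
  qed
  ultimately show ?thesis by blast
qed

section \<open>Honest-referee value after conditioning the questions\<close>

lemma hrNS_star_of_cond_value:
  fixes G :: "('q, 'a) game"
  assumes G: "is_game k G" and \<delta>: "0 < \<delta>" "\<delta> \<le> 1" and \<theta>: "0 < \<theta>"
    and v: "1 - \<epsilon> \<le> game_value k G (subNS k G)" and \<epsilon>: "0 < \<epsilon>"
  shows "\<exists>R. R \<subseteq> set_pmf (qdist G) \<and> R \<noteq> {} \<and> 1 - \<delta> \<le> measure (qdist G) R \<and>
    1 / real k ^ (3 * k) * (1 - real k ^ k * ((\<epsilon> + \<theta>) / \<delta>))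
      \<le> game_value k (star_of k G (cond_pmf (qdist G) R)) (hrNS k (star_of k G (cond_pmf (qdist G) R)))"
proof -
  let ?Q = "qtuples G {1..k}" and ?\<pi> = "qdist G"
  let ?\<eta> = "(\<epsilon> + \<theta>) / \<delta>"
  have finQ: "finite ?Q" by (rule finite_qtuples[OF G]) simp
  obtain a where "a \<in> atuples G {1..k}" using ex_atuple[OF G] by blast
  then have "(\<lambda>_. return_pmf (Some a)) \<in> subNS k G"
    using constant_in_NS[OF G] NS_subset_subNS by blast
  then obtain p where p: "p \<in> subNS k G" and win: "1 - \<epsilon> - \<theta> < win_prob k G p"
    using ex_near_optimal[OF G _ v \<theta>] by blast
  \<comment> \<open>Aborting is one way of failing to win, so on \<open>R\<close> the threshold
    \<open>?\<eta>\<close> bounds the abort probability as well.\<close>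
  define R where "R = {q \<in> set_pmf ?\<pi>. 1 - win_at k G p q \<le> ?\<eta>}"
  have RQ: "R \<subseteq> ?Q" using qdist_subset[OF G] by (auto simp: R_def)
  have win_le: "win_at k G p q \<le> 1" for q
    using win_at_le[OF G, of p q] pmf_nonneg[of "p q" None] by linarith
  have loss: "(\<Sum>q\<in>?Q. pmf ?\<pi> q * (1 - win_at k G p q)) < \<epsilon> + \<theta>"
    using win by (simp add: right_diff_distrib sum_subtractf sum_qdist[OF G] win_prob_eq del: One_nat_def)
  \<comment> \<open>Markov's inequality for the failure probability; outside \<open>R\<close> a
    tuple has either probability 0 or failure probability above \<open>?\<eta>\<close>.\<close>
  have markov: "measure ?\<pi> (?Q - R) * ?\<eta> \<le> (\<Sum>q\<in>?Q. pmf ?\<pi> q * (1 - win_at k G p q))"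
  proof -
    have "measure ?\<pi> (?Q - R) * ?\<eta> = (\<Sum>q\<in>?Q - R. pmf ?\<pi> q * ?\<eta>)"
      using finQ by (simp only: measure_measure_pmf_finite finite_Diff sum_distrib_right)
    also have "\<dots> \<le> (\<Sum>q\<in>?Q - R. pmf ?\<pi> q * (1 - win_at k G p q))"
    proof (rule sum_mono)
      fix q assume "q \<in> ?Q - R"
      then have "q \<notin> set_pmf ?\<pi> \<or> ?\<eta> \<le> 1 - win_at k G p q" by (auto simp: R_def)
      then show "pmf ?\<pi> q * ?\<eta> \<le> pmf ?\<pi> q * (1 - win_at k G p q)"
      proof
        assume "q \<notin> set_pmf ?\<pi>"
        then show ?thesis by (simp add: set_pmf_iff)
      qed (rule mult_left_mono, auto)
    qed
    also have "\<dots> \<le> (\<Sum>q\<in>?Q. pmf ?\<pi> q * (1 - win_at k G p q))"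
      using win_le finQ by (intro sum_mono2) auto
    finally show ?thesis .
  qed
  have "measure ?\<pi> (?Q - R) * (\<epsilon> + \<theta>) / \<delta> < \<epsilon> + \<theta>"
    using le_less_trans[OF markov loss] by (simp only: times_divide_eq_right)
  then have "measure ?\<pi> (?Q - R) * (\<epsilon> + \<theta>) < \<delta> * (\<epsilon> + \<theta>)"
    using \<delta>(1) by (simp only: pos_divide_less_eq mult.commute)
  then have small: "measure ?\<pi> (?Q - R) < \<delta>" using \<epsilon> \<theta> by simp
  have "1 = measure ?\<pi> ?Q"
    using finQ by (simp add: measure_measure_pmf_finite sum_qdist[OF G] del: One_nat_def)
  also have "\<dots> = measure ?\<pi> (?Q - R) + measure ?\<pi> R"
    using RQ by (subst measure_pmf.finite_measure_Union[symmetric]) (auto intro: arg_cong[where f = "measure ?\<pi>"])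
  \<comment> \<open>The inequality is strict because \<open>p\<close> is strictly better than
    \<open>1 - \<epsilon> - \<theta>\<close>; this makes \<open>R\<close> nonempty even for
    \<open>\<delta> = 1\<close>.\<close>
  finally have large: "1 - \<delta> < measure ?\<pi> R" using small by linarith
  then have "R \<noteq> {}" using \<delta> by auto
  have ne: "set_pmf ?\<pi> \<inter> R \<noteq> {}" using \<open>R \<noteq> {}\<close> by (auto simp: R_def)
  have set: "set_pmf (cond_pmf ?\<pi> R) = R"
    using set_cond_pmf[OF ne] by (auto simp: R_def)
  let ?H = "star_of k G (cond_pmf ?\<pi> R)"
  have H: "is_game k ?H"
    using star_game_star_of[OF G, of "cond_pmf ?\<pi> R"] set RQ by (simp add: star_game_def)
  have "pmf (p q) None \<le> ?\<eta>" if "q \<in> R" for q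
    using win_at_le[OF G, of p q] that by (simp add: R_def)
  from star_strategy_exists[OF G RQ p this]
  obtain P where P: "P \<in> consistent_on k ?H R" and P_win: "\<And>q. q \<in> R \<Longrightarrow>
      1 / real k ^ (3 * k) * (win_at k G p q - (real k ^ k - 1) * ?\<eta>) \<le> win_at k ?H P q"
    by metis
  have "1 / real k ^ (3 * k) * (1 - real k ^ k * ?\<eta>) \<le> win_prob k ?H P"
  proof (rule win_prob_ge[OF H])
    fix q assume "q \<in> set_pmf (qdist ?H)"
    then have q: "q \<in> R" by (simp add: set)
    \<comment> \<open>The failure probability adds one \<open>?\<eta>\<close> to the trimming loss
      of \<open>k^k - 1\<close> of them.\<close>
    have "1 - real k ^ k * ?\<eta> \<le> win_at k G p q - (real k ^ k - 1) * ?\<eta>"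
    proof -
      have "1 - win_at k G p q \<le> ?\<eta>" using q by (simp add: R_def)
      moreover have "(real k ^ k - 1) * ?\<eta> = real k ^ k * ?\<eta> - ?\<eta>"
        by (simp only: left_diff_distrib mult_1_left)
      ultimately show ?thesis by linarith
    qed
    then have "1 / real k ^ (3 * k) * (1 - real k ^ k * ?\<eta>)
        \<le> 1 / real k ^ (3 * k) * (win_at k G p q - (real k ^ k - 1) * ?\<eta>)"
      by (rule mult_left_mono) simp
    with P_win[OF q] show "1 / real k ^ (3 * k) * (1 - real k ^ k * ?\<eta>) \<le> win_at k ?H P q"
      by linarith
  qed
  also have "\<dots> \<le> game_value k ?H (hrNS k ?H)"
    using P by (intro win_prob_le_game_value[OF H]) (simp add: hrNS_eq set)
  finally show ?thesis
    using \<open>R \<noteq> {}\<close> large by (intro exI[of _ R]) (auto simp: R_def)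
qed

text \<open>Conditioning removes the mass \<open>1 - measure \<mu> R\<close> outside
  \<open>R\<close> and spreads the same amount over \<open>R\<close>, so the factor 1/2 leaves it
  counted once.\<close>

lemma stat_dist_cond_pmf:
  assumes "finite X" "set_pmf \<mu> \<subseteq> X" "R \<subseteq> set_pmf \<mu>" "R \<noteq> {}"
  shows "stat_dist X \<mu> (cond_pmf \<mu> R) = 1 - measure \<mu> R"
proof -
  let ?M = "measure \<mu> R"
  have ne: "set_pmf \<mu> \<inter> R \<noteq> {}" using assms by auto
  have RX: "R \<subseteq> X" using assms by auto
  have finR: "finite R" using RX assms(1) finite_subset by blast
  have M: "0 < ?M" "?M \<le> 1"
    using ne by (auto simp: measure_pmf_posI)
  have "(\<Sum>x\<in>X. \<bar>pmf \<mu> x - pmf (cond_pmf \<mu> R) x\<bar>)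
      = (\<Sum>x\<in>X - R. \<bar>pmf \<mu> x - pmf (cond_pmf \<mu> R) x\<bar>) + (\<Sum>x\<in>R. \<bar>pmf \<mu> x - pmf (cond_pmf \<mu> R) x\<bar>)"
    by (rule sum.subset_diff[OF RX assms(1)])
  also have "(\<Sum>x\<in>X - R. \<bar>pmf \<mu> x - pmf (cond_pmf \<mu> R) x\<bar>) = (\<Sum>x\<in>X - R. pmf \<mu> x)"
    by (rule sum.cong) (auto simp: pmf_cond[OF ne])
  also have "\<dots> = 1 - ?M"
    using sum_diff[OF assms(1) RX, of "pmf \<mu>"] sum_pmf_eq_1[OF assms(1,2)] finR
    by (simp add: measure_measure_pmf_finite)
  also have "(\<Sum>x\<in>R. \<bar>pmf \<mu> x - pmf (cond_pmf \<mu> R) x\<bar>) = (\<Sum>x\<in>R. pmf \<mu> x * (1 / ?M - 1))"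
  proof (rule sum.cong[OF refl])
    fix x assume "x \<in> R"
    have "pmf \<mu> x * 1 \<le> pmf \<mu> x * (1 / ?M)"
      using M by (intro mult_left_mono) auto
    with \<open>x \<in> R\<close> show "\<bar>pmf \<mu> x - pmf (cond_pmf \<mu> R) x\<bar> = pmf \<mu> x * (1 / ?M - 1)"
      by (simp add: pmf_cond[OF ne] right_diff_distrib)
  qed
  also have "\<dots> = ?M * (1 / ?M - 1)"
    using finR by (simp add: measure_measure_pmf_finite sum_distrib_right)
  also have "\<dots> = 1 - ?M" using M by (simp add: field_simps)
  finally show ?thesis by (simp add: stat_dist_def)
qed

lemma stat_dist_le_1:
  assumes "finite X" "set_pmf \<mu> \<subseteq> X" "set_pmf \<nu> \<subseteq> X"
  shows "stat_dist X \<mu> \<nu> \<le> 1"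
proof -
  have "(\<Sum>x\<in>X. \<bar>pmf \<mu> x - pmf \<nu> x\<bar>) \<le> (\<Sum>x\<in>X. pmf \<mu> x + pmf \<nu> x)"
  proof (rule sum_mono)
    fix x show "\<bar>pmf \<mu> x - pmf \<nu> x\<bar> \<le> pmf \<mu> x + pmf \<nu> x"
      using pmf_nonneg[of \<mu> x] pmf_nonneg[of \<nu> x] by linarith
  qed
  then show ?thesis
    using assms by (simp add: stat_dist_def sum.distrib sum_pmf_eq_1)
qed

text \<open>For \<open>\<delta> \<le> 1\<close> the slack \<open>\<theta>\<close> is removed from
  the conditioned games. For \<open>\<delta> > 1\<close> every question distribution is close
  enough, and a point mass on a question tuple with an accepted answer tuple gives value at least
  1.\<close>

lemma star_game_hrNS_value:
  fixes G :: "('q, 'a) game"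
  assumes G: "is_game k G" and \<epsilon>: "0 < \<epsilon>" and \<delta>: "0 < \<delta>"
    and v: "1 - \<epsilon> \<le> game_value k G (subNS k G)" and triv: "\<epsilon> < 1 \<or> \<delta> \<le> 1"
  shows "\<exists>H :: ('q, 'a option) game. star_game k G H \<and>
    stat_dist (qtuples G {1..k}) (qdist G) (qdist H) \<le> \<delta> \<and>
    1 / real k ^ (3 * k) * (1 - real k ^ k * (\<epsilon> / \<delta>)) \<le> game_value k H (hrNS k H)"
proof (cases "\<delta> \<le> 1")
  case True
  let ?H = "\<lambda>R. star_of k G (cond_pmf (qdist G) R)"
  let ?val = "\<lambda>R. game_value k (?H R) (hrNS k (?H R))"
  let ?c = "1 / real k ^ (3 * k)"
  \<comment> \<open>The conditioning set depends on \<open>\<theta>\<close>. There are only finitely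
    many candidates, so one of largest value works for every \<open>\<theta>\<close>.\<close>
  define \<R> where "\<R> = {R. R \<subseteq> set_pmf (qdist G) \<and> R \<noteq> {} \<and> 1 - \<delta> \<le> measure (qdist G) R}"
  have finQ: "finite (qtuples G {1..k})" by (rule finite_qtuples[OF G]) simp
  have "finite (set_pmf (qdist G))"
    using finQ qdist_subset[OF G] by (rule rev_finite_subset)
  then have fin: "finite \<R>" unfolding \<R>_def by simp
  have near: "\<exists>R\<in>\<R>. ?c * (1 - real k ^ k * ((\<epsilon> + \<theta>) / \<delta>)) \<le> ?val R" if "\<theta> > 0" for \<theta>
    using hrNS_star_of_cond_value[OF G \<delta> True that v \<epsilon>] unfolding \<R>_def by blast
  then have "\<R> \<noteq> {}" using zero_less_one by blast
  with fin have "Max (?val ` \<R>) \<in> ?val ` \<R>" by (intro Max_in) auto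
  then obtain R where R: "R \<in> \<R>" "Max (?val ` \<R>) = ?val R" by blast
  have max: "?val R' \<le> ?val R" if "R' \<in> \<R>" for R'
    using Max_ge[of "?val ` \<R>" "?val R'"] fin that R(2) by simp
  have "?c * (1 - real k ^ k * (\<epsilon> / \<delta>)) \<le> ?val R"
  proof (rule le_of_le_add_scaled)
    show "0 \<le> ?c * (real k ^ k / \<delta>)" using \<delta> by simp
    fix \<theta> :: real assume "\<theta> > 0"
    then obtain R' where "R' \<in> \<R>" "?c * (1 - real k ^ k * ((\<epsilon> + \<theta>) / \<delta>)) \<le> ?val R'"
      using near by blast
    then have "?c * (1 - real k ^ k * ((\<epsilon> + \<theta>) / \<delta>)) \<le> ?val R"
      using max by (meson order_trans)
    moreover have "1 - real k ^ k * ((\<epsilon> + \<theta>) / \<delta>)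
        = 1 - real k ^ k * (\<epsilon> / \<delta>) - \<theta> * (real k ^ k / \<delta>)"
      by (simp add: add_divide_distrib algebra_simps)
    then have "?c * (1 - real k ^ k * (\<epsilon> / \<delta>)) - \<theta> * (?c * (real k ^ k / \<delta>))
        = ?c * (1 - real k ^ k * ((\<epsilon> + \<theta>) / \<delta>))"
      by (simp only: right_diff_distrib mult.left_commute[of \<theta>])
    ultimately show "?c * (1 - real k ^ k * (\<epsilon> / \<delta>)) - \<theta> * (?c * (real k ^ k / \<delta>)) \<le> ?val R"
      by simp
  qed
  moreover have "set_pmf (cond_pmf (qdist G) R) \<subseteq> qtuples G {1..k}"
    using R qdist_subset[OF G] by (subst set_cond_pmf) (auto simp: \<R>_def)
  then have "star_game k G (?H R)" by (rule star_game_star_of[OF G])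
  moreover have "stat_dist (qtuples G {1..k}) (qdist G) (qdist (?H R)) \<le> \<delta>"
    using R stat_dist_cond_pmf[OF finQ qdist_subset[OF G], of R] by (simp add: \<R>_def)
  ultimately show ?thesis by blast
next
  case False
  have finQ: "finite (qtuples G {1..k})" by (rule finite_qtuples[OF G]) simp
  obtain a where a: "a \<in> atuples G {1..k}" using ex_atuple[OF G] by blast
  then have "(\<lambda>_. return_pmf (Some a)) \<in> subNS k G"
    using constant_in_NS[OF G] NS_subset_subNS by blast
  \<comment> \<open>Here \<open>\<epsilon> < 1\<close>, so some strategy wins with positive
    probability and hence some answer tuple is accepted.\<close>
  moreover have "1 - \<epsilon> > 0" using triv False by simp
  ultimately obtain p where "1 - \<epsilon> - (1 - \<epsilon>) < win_prob k G p"
    using ex_near_optimal[OF G _ v, of "1 - \<epsilon>"] by blast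
  then have "win_prob k G p \<noteq> 0" by simp
  then obtain q where q: "q \<in> qtuples G {1..k}" and "pmf (qdist G) q * win_at k G p q \<noteq> 0"
    unfolding win_prob_eq by (rule sum.not_neutral_contains_not_neutral)
  then have "win_at k G p q \<noteq> 0" by auto
  then obtain b where b: "b \<in> atuples G {1..k}"
    and "pmf (p q) (Some b) * of_bool (accepts G q b) \<noteq> 0"
    unfolding win_at_def by (rule sum.not_neutral_contains_not_neutral)
  then have acc: "accepts G q b" by (cases "accepts G q b") auto
  let ?H = "star_of k G (return_pmf q)" and ?P = "\<lambda>_. return_pmf (Some (embed_answers k b))"
  have star: "star_game k G ?H" using q by (intro star_game_star_of G) simp
  then have H: "is_game k ?H" by (simp add: star_game_def)
  have "?P \<in> NS k ?H"
    by (rule constant_in_NS[OF H]) (rule embed_answers_in[OF b])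
  then have P: "?P \<in> hrNS k ?H"
    unfolding NS_eq hrNS_eq consistent_on_def mem_Collect_eq using q by auto
  have "1 \<le> win_prob k ?H ?P"
  proof (rule win_prob_ge[OF H])
    fix q' assume "q' \<in> set_pmf (qdist ?H)"
    then have "q' = q" by simp
    then show "1 \<le> win_at k ?H ?P q'"
      unfolding win_at_star_of[OF G]
      using member_le_sum[of b "atuples G {1..k}" "\<lambda>c. pmf (return_pmf (Some (embed_answers k b)))
        (Some (embed_answers k c)) * of_bool (accepts G q c)"] b acc finite_atuples[OF G, of "{1..k}"]
      by simp
  qed
  also have "\<dots> \<le> game_value k ?H (hrNS k ?H)" by (rule win_prob_le_game_value[OF H P])
  finally have "1 \<le> game_value k ?H (hrNS k ?H)" .
  moreover have "1 / real k ^ (3 * k) * (1 - real k ^ k * (\<epsilon> / \<delta>)) \<le> 1"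
  proof -
    have "1 \<le> real k ^ (3 * k)" by (cases "k = 0") (auto simp: one_le_power)
    moreover have "1 - real k ^ k * (\<epsilon> / \<delta>) \<le> 1" using \<epsilon> \<delta> by simp
    ultimately show ?thesis by (simp add: divide_le_eq)
  qed
  moreover have "stat_dist (qtuples G {1..k}) (qdist G) (qdist ?H) \<le> \<delta>"
    using stat_dist_le_1[OF finQ qdist_subset[OF G], of "return_pmf q"] q False by simp
  ultimately show ?thesis using star by (intro exI[of _ ?H]) auto
qed

section \<open>Non-signaling value with the question distribution unchanged\<close>

lemma star_of_NS_value:
  fixes G :: "('q, 'a) game"
  assumes G: "is_game k G" and \<delta>: "0 \<le> \<delta>"
    and v: "1 - \<epsilon> \<le> game_value k G (subNS_le \<delta> k G)"
  shows "1 / real k ^ (3 * k) * (1 - \<epsilon> - (real k ^ k - 1) * \<delta>)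
    \<le> game_value k (star_of k G (qdist G)) (NS k (star_of k G (qdist G)))"
proof (rule le_of_le_add_scaled)
  let ?H = "star_of k G (qdist G)" and ?c = "1 / real k ^ (3 * k)" and ?Q = "qtuples G {1..k}"
  show "0 \<le> ?c" by simp
  fix \<theta> :: real assume \<theta>: "\<theta> > 0"
  have H: "is_game k ?H"
    using star_game_star_of[OF G qdist_subset[OF G]] by (simp add: star_game_def)
  obtain a where a: "a \<in> atuples G {1..k}" using ex_atuple[OF G] by blast
  then have "(\<lambda>_. return_pmf (Some a)) \<in> subNS k G"
    using constant_in_NS[OF G] NS_subset_subNS by blast
  then have "(\<lambda>_. return_pmf (Some a)) \<in> subNS_le \<delta> k G"
    using \<delta> by (simp add: subNS_le_def)
  then obtain p where p: "p \<in> subNS_le \<delta> k G" and win: "1 - \<epsilon> - \<theta> < win_prob k G p"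
    using ex_near_optimal[OF G _ v \<theta>] by blast
  from p have "p \<in> subNS k G" "\<And>q. q \<in> ?Q \<Longrightarrow> pmf (p q) None \<le> \<delta>"
    by (auto simp: subNS_le_def)
  from star_strategy_exists[OF G order_refl this]
  obtain P where P: "P \<in> consistent_on k ?H ?Q" and P_win: "\<And>q. q \<in> ?Q \<Longrightarrow>
      ?c * (win_at k G p q - (real k ^ k - 1) * \<delta>) \<le> win_at k ?H P q"
    by metis
  have "?c * (1 - \<epsilon> - (real k ^ k - 1) * \<delta>) - \<theta> * ?c
      = ?c * (1 - \<epsilon> - \<theta> - (real k ^ k - 1) * \<delta>)"
    by (simp only: right_diff_distrib left_diff_distrib mult.commute[of \<theta>])
  also have "\<dots> \<le> ?c * (win_prob k G p - (real k ^ k - 1) * \<delta>)"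
    using win by (intro mult_left_mono) auto
  \<comment> \<open>The pointwise bound is affine in \<open>win_at\<close>, so averaging over
    \<open>qdist G\<close> needs no Markov argument.\<close>
  also have "\<dots> = (\<Sum>q\<in>?Q. pmf (qdist G) q * (?c * (win_at k G p q - (real k ^ k - 1) * \<delta>)))"
  proof -
    have "(\<Sum>q\<in>?Q. pmf (qdist G) q * (win_at k G p q - (real k ^ k - 1) * \<delta>))
        = win_prob k G p - (\<Sum>q\<in>?Q. pmf (qdist G) q) * ((real k ^ k - 1) * \<delta>)"
      unfolding right_diff_distrib[of "pmf _ _"] sum_subtractf sum_distrib_right win_prob_eq ..
    then have "?c * (win_prob k G p - (real k ^ k - 1) * \<delta>)
        = ?c * (\<Sum>q\<in>?Q. pmf (qdist G) q * (win_at k G p q - (real k ^ k - 1) * \<delta>))"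
      by (simp add: sum_qdist[OF G] del: One_nat_def)
    then show ?thesis by (simp only: sum_distrib_left mult.left_commute)
  qed
  also have "\<dots> \<le> win_prob k ?H P"
    unfolding win_prob_eq star_of_simps using P_win by (intro sum_mono mult_left_mono) auto
  also have "\<dots> \<le> game_value k ?H (NS k ?H)"
    using P by (intro win_prob_le_game_value[OF H]) (simp add: NS_eq)
  finally show "?c * (1 - \<epsilon> - (real k ^ k - 1) * \<delta>) - \<theta> * ?c \<le> game_value k ?H (NS k ?H)" .
qed

lemma NS_value_nonneg:
  assumes G: "is_game k G"
  shows "0 \<le> game_value k G (NS k G)"
proof -
  obtain a where "a \<in> atuples G {1..k}" using ex_atuple[OF G] by blast
  then have "win_prob k G (\<lambda>_. return_pmf (Some a)) \<le> game_value k G (NS k G)"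
    by (intro win_prob_le_game_value[OF G] constant_in_NS[OF G])
  moreover have "0 \<le> win_prob k G (\<lambda>_. return_pmf (Some a))"
    by (rule win_prob_ge[OF G win_at_nonneg])
  ultimately show ?thesis by linarith
qed

theorem theorem5p1:
  fixes k :: nat and G :: "('q, 'a) game" and \<epsilon> \<delta> :: real
  assumes "is_game k G" and "\<epsilon> > 0" and "\<delta> > 0"
  shows "(game_value k G (subNS k G) \<ge> 1 - \<epsilon> \<and> (\<epsilon> < 1 \<or> \<delta> \<le> 1) \<longrightarrow>
           (\<exists>H :: ('q, 'a option) game. star_game k G H \<and>
              stat_dist (qtuples G {1..k}) (qdist G) (qdist H) \<le> \<delta> \<and>
              game_value k H (hrNS k H) \<ge>
                1 / real k ^ (3 * k) * (1 - real k ^ (2 * k) * \<epsilon> / \<delta>))) \<and>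
         (game_value k G (subNS_le \<delta> k G) \<ge> 1 - \<epsilon> \<and> \<delta> \<le> sqrt \<epsilon> \<longrightarrow>
           (\<exists>H :: ('q, 'a option) game. star_game k G H \<and>
              qdist H = qdist G \<and>
              game_value k H (NS k H) \<ge>
                1 / real k ^ (3 * k) * (1 - real k ^ (2 * k) * \<epsilon> / \<delta>)))"
proof (intro conjI impI; elim conjE)
  let ?c = "1 / real k ^ (3 * k)"
  have kk: "1 \<le> real k ^ k" "real k ^ k \<le> real k ^ (2 * k)"
    by (cases "k = 0"; simp add: one_le_power power_increasing)+
  \<comment> \<open>The construction achieves the constant \<open>k^k\<close>, which is at most
    \<open>k^(2k)\<close>; for \<open>k = 0\<close> both are 1.\<close>
  have weaken: "?c * (1 - real k ^ (2 * k) * \<epsilon> / \<delta>) \<le> ?c * (1 - real k ^ k * (\<epsilon> / \<delta>))"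
    using kk(2) assms(2,3) by (intro mult_left_mono) (auto intro!: divide_right_mono mult_right_mono)
  {
    assume v: "1 - \<epsilon> \<le> game_value k G (subNS k G)" and "\<epsilon> < 1 \<or> \<delta> \<le> 1"
    then obtain H :: "('q, 'a option) game" where "star_game k G H"
      "stat_dist (qtuples G {1..k}) (qdist G) (qdist H) \<le> \<delta>"
      "?c * (1 - real k ^ k * (\<epsilon> / \<delta>)) \<le> game_value k H (hrNS k H)"
      using star_game_hrNS_value[OF assms] by metis
    with weaken show "\<exists>H :: ('q, 'a option) game. star_game k G H \<and>
        stat_dist (qtuples G {1..k}) (qdist G) (qdist H) \<le> \<delta> \<and>
        ?c * (1 - real k ^ (2 * k) * \<epsilon> / \<delta>) \<le> game_value k H (hrNS k H)"
      by (meson order_trans)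
  next
    assume v: "1 - \<epsilon> \<le> game_value k G (subNS_le \<delta> k G)" and \<delta>: "\<delta> \<le> sqrt \<epsilon>"
    let ?H = "star_of k G (qdist G)"
    have star: "star_game k G ?H"
      by (rule star_game_star_of[OF assms(1) qdist_subset[OF assms(1)]])
    \<comment> \<open>The assumption on \<open>\<delta>\<close> amounts to
      \<open>\<delta> \<le> \<epsilon> / \<delta>\<close>, so the abort bound can be replaced by
      \<open>\<epsilon> / \<delta>\<close>.\<close>
    have "\<delta> ^ 2 \<le> \<epsilon>"
      using \<delta> assms(2,3) by (metis less_imp_le power_mono real_sqrt_pow2)
    then have le: "\<delta> \<le> \<epsilon> / \<delta>" using assms(3) by (simp add: field_simps power2_eq_square)
    have "?c * (1 - real k ^ (2 * k) * \<epsilon> / \<delta>) \<le> game_value k ?H (NS k ?H)"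
    proof (cases "\<delta> \<le> 1")
      case True
      then have "\<epsilon> \<le> \<epsilon> / \<delta>" using assms(2,3) by (simp add: field_simps)
      moreover have "(real k ^ k - 1) * \<delta> \<le> (real k ^ k - 1) * (\<epsilon> / \<delta>)"
        using kk(1) le by (intro mult_left_mono) auto
      moreover have "(real k ^ k - 1) * (\<epsilon> / \<delta>) = real k ^ k * (\<epsilon> / \<delta>) - \<epsilon> / \<delta>"
        by (simp only: left_diff_distrib mult_1_left)
      ultimately have "1 - real k ^ k * (\<epsilon> / \<delta>) \<le> 1 - \<epsilon> - (real k ^ k - 1) * \<delta>"
        by linarith
      then have "?c * (1 - real k ^ k * (\<epsilon> / \<delta>)) \<le> ?c * (1 - \<epsilon> - (real k ^ k - 1) * \<delta>)"
        by (rule mult_left_mono) simp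
      with weaken star_of_NS_value[OF assms(1) less_imp_le[OF assms(3)] v] show ?thesis by linarith
    next
      case False
      \<comment> \<open>For \<open>\<delta> > 1\<close> the claimed lower bound is not positive, and
        values are nonnegative.\<close>
      then have "1 \<le> \<epsilon> / \<delta>" "1 \<le> real k ^ (2 * k)" using le kk by linarith+
      then have "1 * 1 \<le> real k ^ (2 * k) * (\<epsilon> / \<delta>)"
        by (intro mult_mono) auto
      then have "?c * (1 - real k ^ (2 * k) * \<epsilon> / \<delta>) \<le> 0"
        by (intro mult_nonneg_nonpos) auto
      with NS_value_nonneg[of k ?H] star show ?thesis
        by (simp add: star_game_def)
    qed
    with star show "\<exists>H :: ('q, 'a option) game. star_game k G H \<and> qdist H = qdist G \<and>
        ?c * (1 - real k ^ (2 * k) * \<epsilon> / \<delta>) \<le> game_value k H (NS k H)"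
      by (intro exI[of _ ?H]) simp
  }
qed

end
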